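(* There is a universal constant $C<\infty$ such that the following holds. Let the candidate-ability distribution $F$ be discrete, supported on $0\le\theta_1<\theta_2<\dots<\theta_m\le1$ with probability masses $p_1,\dots,p_m>0$, and let $\varepsilon_0=\min\{p_1,\dots,p_m\}$. Then, for the multisecretary problem, for all $T\in\mathbb N$ and all $B\in[T]$, $$\mathrm{Regret}(B,T;\mathrm{CwG})\le\frac{C\sqrt{\log(1/\varepsilon_0)}}{\varepsilon_0}.$$
   Context: Multisecretary problem: horizon $T\in\mathbb N$, hiring budget $B\in[T]=\{1,\dots,T\}$. Abilities (one per time $t=1,\dots,T$) are i.i.d. from a known distribution with CDF $F$ on $[0,1]$; write $\vartheta_t$ for the ability at time $t$. At each time $t$, after observing $\vartheta_t$, the decision maker irrevocably accepts ($a_t=1$) or rejects ($a_t=0$); at most $B$ acceptances in total; policies may be randomized and must be non-anticipating. $\mathrm{Regret}(B,T;\pi)=\mathbb E\big[\max\{\sum_t\vartheta_t a_t:a\in\{0,1\}^T,\sum_t a_t\le B\}\big]-\mathbb E[\sum_t\vartheta_t a_t^\pi]$. CwG policy: for the discrete distribution above use the gap quantiles $q_i^\star=\sum_{j=1}^ip_j$, $i=1,\dots,m-1$, and $\varepsilon_0=\min_jp_j$. Let $F^{-1}(q)=\inf\{v:F(v)\ge q\}$. Set $B_1=B$ and $\tilde T=\max\{0,T-\lfloor 64\log(1/\varepsilon_0)/\varepsilon_0^2\rfloor\}$. Phase 1, $t=1,\dots,\tilde T$: let $p_t^{CE}=1-\frac{B_t}{T-t+1}$ and $\mathcal S_t=\{i:|p_t^{CE}-q_i^\star|\le\sqrt{2\log(T-t+1)/(T-t+1)}\}$.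 If $\mathcal S_t=\emptyset$ set $p_t^{CwG}=p_t^{CE}$; otherwise set $p_t^{CwG}=q_j^\star$ with $j\in\arg\min_{i\in\mathcal S_t}|p_t^{CE}-q_i^\star|$. Observe $\vartheta_t$, and draw $X_t$ uniformly at random from $\mathcal I_t=\{q\in[0,1]:F^{-1}(q)=\vartheta_t\}$. If $X_t\ge p_t^{CwG}$ and $B_t>0$, accept and set $B_{t+1}=B_t-1$; otherwise reject and set $B_{t+1}=B_t$. Phase 2, $t=\tilde T+1,\dots,T$: same acceptance rule, with the fixed threshold $p_{\tilde T+1}^{CE}=1-\frac{B_{\tilde T+1}}{T-\tilde T}$ in place of $p_t^{CwG}$. *)

theory Defs
  imports "HOL-Probability.Probability"
begin

section \<open>The multisecretary problem\<close>

text \<open>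
  The infimum is taken over \<open>[0,1]\<close>, where the distribution lives; over all of \<open>real\<close> the set is
  unbounded below for \<open>q = 0\<close>.
\<close>

definition quantile :: "real pmf \<Rightarrow> real \<Rightarrow> real" where
  "quantile F q = Inf {v \<in> {0..1}. q \<le> cdf (measure_pmf F) v}"

definition quantile_fiber :: "real pmf \<Rightarrow> real \<Rightarrow> real set" where
  "quantile_fiber F v = {q \<in> {0..1}. quantile F q = v}"

text \<open>
  Joint law of \<open>(\<vartheta>\<^sub>t, X\<^sub>t)\<close>: the ability \<open>\<vartheta>\<^sub>t\<close> has law \<open>F\<close> and, given \<open>\<vartheta>\<^sub>t = v\<close>, the auxiliary variable
  \<open>X\<^sub>t\<close> is uniform on \<open>{q \<in> [0,1]. F\<inverse>(q) = v}\<close>. If \<open>v\<close> is an atom of \<open>F\<close>, this fiber is an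
  interval of length \<open>pmf F v > 0\<close>; other values of \<open>v\<close> have probability zero.
\<close>

definition candidate :: "real pmf \<Rightarrow> (real \<times> real) measure" where
  "candidate F =
     measure_pmf F \<bind> (\<lambda>v. distr (uniform_measure lborel (quantile_fiber F v)) borel (Pair v))"

definition candidates :: "real pmf \<Rightarrow> nat \<Rightarrow> (nat \<Rightarrow> real \<times> real) measure" where
  "candidates F T = (\<Pi>\<^sub>M t\<in>{1..T}. candidate F)"

abbreviation ability :: "(nat \<Rightarrow> real \<times> real) \<Rightarrow> nat \<Rightarrow> real" where
  "ability \<omega> t \<equiv> fst (\<omega> t)"

abbreviation aux :: "(nat \<Rightarrow> real \<times> real) \<Rightarrow> nat \<Rightarrow> real" where
  "aux \<omega> t \<equiv> snd (\<omega> t)"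

definition hindsight_optimum :: "nat \<Rightarrow> nat \<Rightarrow> (nat \<Rightarrow> real) \<Rightarrow> real" where
  "hindsight_optimum B T v =
     Max {\<Sum>t=1..T. v t * real (a t) | a. a \<in> {1..T} \<rightarrow>\<^sub>E {0, 1::nat} \<and> (\<Sum>t=1..T. a t) \<le> B}"

text \<open>A policy is represented by the \<open>0/1\<close> actions \<open>\<pi> \<omega> t\<close> it takes along the sample path \<open>\<omega>\<close>.\<close>

definition regret ::
  "real pmf \<Rightarrow> nat \<Rightarrow> nat \<Rightarrow> ((nat \<Rightarrow> real \<times> real) \<Rightarrow> nat \<Rightarrow> nat) \<Rightarrow> real" where
  "regret F B T \<pi> =
     (\<integral>\<omega>. hindsight_optimum B T (ability \<omega>) \<partial>candidates F T)
       - (\<integral>\<omega>. (\<Sum>t=1..T. ability \<omega> t * real (\<pi> \<omega> t)) \<partial>candidates F T)"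


section \<open>The policy CwG\<close>

definition min_mass :: "nat \<Rightarrow> (nat \<Rightarrow> real) \<Rightarrow> real" where
  "min_mass m p = Min (p ` {1..m})"

definition gap_quantile :: "(nat \<Rightarrow> real) \<Rightarrow> nat \<Rightarrow> real" where
  "gap_quantile p i = (\<Sum>j=1..i. p j)"

definition phase1_length :: "nat \<Rightarrow> (nat \<Rightarrow> real) \<Rightarrow> nat \<Rightarrow> nat" where
  "phase1_length m p T =
     nat (max 0 (int T - \<lfloor>64 * ln (1 / min_mass m p) / (min_mass m p)\<^sup>2\<rfloor>))"

definition p_CE :: "nat \<Rightarrow> nat \<Rightarrow> nat \<Rightarrow> real" where
  "p_CE T t b = 1 - real b / (real T - real t + 1)"

definition near_gaps :: "nat \<Rightarrow> (nat \<Rightarrow> real) \<Rightarrow> nat \<Rightarrow> nat \<Rightarrow> nat \<Rightarrow> nat set" where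
  "near_gaps m p T t b =
     {i \<in> {1..m - 1}. \<bar>p_CE T t b - gap_quantile p i\<bar>
        \<le> sqrt (2 * ln (real T - real t + 1) / (real T - real t + 1))}"

text \<open>
  The policy leaves open which minimizer is used if there are several; \<open>sel t b\<close> is
  the index chosen at time \<open>t\<close> with remaining budget \<open>b\<close>.
\<close>

definition nearest_gap_selection ::
  "nat \<Rightarrow> (nat \<Rightarrow> real) \<Rightarrow> nat \<Rightarrow> (nat \<Rightarrow> nat \<Rightarrow> nat) \<Rightarrow> bool" where
  "nearest_gap_selection m p T sel \<longleftrightarrow>
     (\<forall>t\<in>{1..T}. \<forall>b. near_gaps m p T t b \<noteq> {} \<longrightarrow>
        is_arg_min (\<lambda>i. \<bar>p_CE T t b - gap_quantile p i\<bar>) (\<lambda>i. i \<in> near_gaps m p T t b) (sel t b))"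

definition p_CwG ::
  "nat \<Rightarrow> (nat \<Rightarrow> real) \<Rightarrow> nat \<Rightarrow> (nat \<Rightarrow> nat \<Rightarrow> nat) \<Rightarrow> nat \<Rightarrow> nat \<Rightarrow> real" where
  "p_CwG m p T sel t b =
     (if near_gaps m p T t b = {} then p_CE T t b else gap_quantile p (sel t b))"

text \<open>
  \<open>cwg_budget \<dots> t\<close> is the budget \<open>B\<^sub>t\<close> available at the beginning of period \<open>t \<ge> 1\<close>, and
  \<open>cwg_threshold \<dots> t\<close> is the threshold applied in period \<open>t\<close>.
\<close>

function cwg_budget ::
    "nat \<Rightarrow> (nat \<Rightarrow> real) \<Rightarrow> nat \<Rightarrow> nat \<Rightarrow> (nat \<Rightarrow> nat \<Rightarrow> nat) \<Rightarrow> (nat \<Rightarrow> real \<times> real) \<Rightarrow> nat \<Rightarrow> nat"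
  and cwg_threshold ::
    "nat \<Rightarrow> (nat \<Rightarrow> real) \<Rightarrow> nat \<Rightarrow> nat \<Rightarrow> (nat \<Rightarrow> nat \<Rightarrow> nat) \<Rightarrow> (nat \<Rightarrow> real \<times> real) \<Rightarrow> nat \<Rightarrow> real"
where
  "cwg_budget m p T B sel \<omega> t =
     (if t \<le> 1 then B
      else if cwg_threshold m p T B sel \<omega> (t - 1) \<le> aux \<omega> (t - 1)
              \<and> 0 < cwg_budget m p T B sel \<omega> (t - 1)
      then cwg_budget m p T B sel \<omega> (t - 1) - 1
      else cwg_budget m p T B sel \<omega> (t - 1))"
| "cwg_threshold m p T B sel \<omega> t =
     (if t \<le> phase1_length m p T then p_CwG m p T sel t (cwg_budget m p T B sel \<omega> t)
      else p_CE T (phase1_length m p T + 1)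
             (cwg_budget m p T B sel \<omega> (phase1_length m p T + 1)))"
  by pat_completeness auto
termination
  by (relation "Wellfounded.measure (case_sum (\<lambda>(m, p, T, B, sel, \<omega>, t). 2 * t)
        (\<lambda>(m, p, T, B, sel, \<omega>, t). 2 * t + 1))") auto

declare cwg_budget.simps [simp del] cwg_threshold.simps [simp del]

definition cwg ::
  "nat \<Rightarrow> (nat \<Rightarrow> real) \<Rightarrow> nat \<Rightarrow> nat \<Rightarrow> (nat \<Rightarrow> nat \<Rightarrow> nat) \<Rightarrow> (nat \<Rightarrow> real \<times> real) \<Rightarrow> nat \<Rightarrow> nat" where
  "cwg m p T B sel \<omega> t =
     (if cwg_threshold m p T B sel \<omega> t \<le> aux \<omega> t \<and> 0 < cwg_budget m p T B sel \<omega> t then 1 else 0)"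

lemma cwg_budget_Suc:
  assumes "1 \<le> t"
  shows "cwg_budget m p T B sel \<omega> (Suc t) = cwg_budget m p T B sel \<omega> t - cwg m p T B sel \<omega> t"
  using assms by (subst cwg_budget.simps) (simp add: cwg_def)

lemma cwg_budget_add_sum:
  "cwg_budget m p T B sel \<omega> (Suc n) + (\<Sum>t=1..n. cwg m p T B sel \<omega> t) = B"
proof (induction n)
  case 0
  show ?case by (subst cwg_budget.simps) simp
next
  case (Suc n)
  have "cwg m p T B sel \<omega> (Suc n) \<le> cwg_budget m p T B sel \<omega> (Suc n)"
    by (simp add: cwg_def)
  with Suc show ?case by (simp add: cwg_budget_Suc)
qed

lemma cwg_feasible: "(\<Sum>t=1..T. cwg m p T B sel \<omega> t) \<le> B"
  using cwg_budget_add_sum[of m p T B sel \<omega> T] by linarith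

end

theory Submission imports Defs begin

text \<open>
  The regret is compared with the hindsight optimum of the \<^emph>\<open>remaining\<close> problem. Along a sample path,
  let \<open>V\<^sub>t\<close> be the largest total ability that can be collected in the periods \<open>t, \<dots>, T\<close> with
  the budget \<open>B\<^sub>t\<close> that the policy has left. Then \<open>V\<^sub>1\<close> is the hindsight optimum, and \<open>V\<^sub>t\<close> exceeds the
  reward of period \<open>t\<close> plus \<open>V\<^sub>t\<^sub>+\<^sub>1\<close> by at most \<open>1\<close>. There is no excess at all unless the policy
  rejects a candidate although fewer than \<open>B\<^sub>t\<close> later candidates are at least as good, or accepts one
  although at least \<open>B\<^sub>t\<close> later candidates are strictly better (\<open>best_reject\<close>, \<open>best_accept\<close>).

  In the first phase these errors are rare. Put \<open>n = T - t + 1\<close>, let \<open>q\<^sub>k\<close> be the gap quantiles, and let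
  \<open>r = sqrt (2 ln n / n)\<close> be the radius within which a gap quantile counts as near. Because
  \<open>n > 64 ln (1/\<epsilon>\<^sub>0) / \<epsilon>\<^sub>0\<^sup>2\<close>, the radius is at most \<open>\<epsilon>\<^sub>0/2\<close> if \<open>m \<ge> 2\<close>. Hence, whichever threshold is used, a
  rejected candidate that is not of the lowest type lies above some \<open>q\<^sub>k \<le> p\<^sup>C\<^sup>E - r\<close>, and an accepted
  one that is not of the highest type lies below some \<open>q\<^sub>k \<ge> p\<^sup>C\<^sup>E + r\<close>. Rejecting the
  lowest type or accepting the highest one is never an error. Any other error therefore forces the
  number of later candidates above \<open>q\<^sub>k\<close> to miss its mean by at least \<open>n r - 1\<close>, for some \<open>k\<close>. This
  event does not mention the budget, so no conditioning on the past is involved: Hoeffding's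
  inequality and a union bound over the at most \<open>1/\<epsilon>\<^sub>0 \<le> n\<close> values of \<open>k\<close> give probability at most
  \<open>2/n\<^sup>2\<close> (\<open>prob_not_concentrated\<close>), and the first phase costs at most \<open>2\<close> in total.

  The second phase has \<open>n \<le> 64 ln (1/\<epsilon>\<^sub>0) / \<epsilon>\<^sub>0\<^sup>2\<close> periods, starts with some budget \<open>b\<close>, and uses the
  fixed threshold \<open>1 - b/n\<close>. Its loss is at most the distance between the number of candidates above the
  threshold and \<open>min b n\<close>. Given the past, that number is binomial with mean \<open>min b n\<close>, so the
  expected distance is at most \<open>sqrt n \<le> 8 sqrt (ln (1/\<epsilon>\<^sub>0)) / \<epsilon>\<^sub>0\<close>. This term has the order of the
  claimed bound. If \<open>m \<ge> 2\<close>, then \<open>\<epsilon>\<^sub>0 \<le> 1/2\<close>, so the constant from the first phase is absorbed and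
  \<open>C = 10\<close> suffices; for \<open>m = 1\<close> both contributions vanish.
\<close>

section \<open>Hindsight optima of subproblems\<close>

text \<open>
  Sets of accepted candidates replace the \<open>0/1\<close> vectors of the hindsight optimum, so that the
  subproblem of any set of periods with any budget can be expressed and solutions can be changed by
  exchanging elements.
\<close>

definition best :: "'a set \<Rightarrow> nat \<Rightarrow> ('a \<Rightarrow> real) \<Rightarrow> real" where
  "best A b v = Max (sum v ` {S. S \<subseteq> A \<and> card S \<le> b})"

lemma sum_le_best:
  assumes "finite A" "S \<subseteq> A" "card S \<le> b"
  shows "sum v S \<le> best A b v"
  unfolding best_def using assms by (intro Max_ge) auto

lemma best_le:
  assumes "finite A" "\<And>S. S \<subseteq> A \<Longrightarrow> card S \<le> b \<Longrightarrow> sum v S \<le> c"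
  shows "best A b v \<le> c"
  unfolding best_def using assms by (subst Max_le_iff) (auto intro!: exI[of _ "{}"])

definition feasible_actions :: "nat \<Rightarrow> nat \<Rightarrow> (nat \<Rightarrow> nat) set" where
  "feasible_actions B T = {a \<in> {1..T} \<rightarrow>\<^sub>E {0, 1}. (\<Sum>t=1..T. a t) \<le> B}"

lemma hindsight_optimum_eq_Max:
  "hindsight_optimum B T v = Max ((\<lambda>a. \<Sum>t=1..T. v t * real (a t)) ` feasible_actions B T)"
  unfolding hindsight_optimum_def feasible_actions_def by (intro arg_cong[where f = Max]) auto

lemma finite_feasible_actions: "finite (feasible_actions B T)"
  by (rule finite_subset[of _ "{1..T} \<rightarrow>\<^sub>E {0, 1}"]) (auto simp: feasible_actions_def intro!: finite_PiE)

lemma feasible_actions_nonempty: "feasible_actions B T \<noteq> {}"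
proof -
  have "(\<lambda>t\<in>{1..T}. 0) \<in> feasible_actions B T" by (auto simp: feasible_actions_def PiE_iff)
  thus ?thesis by blast
qed

lemma hindsight_optimum_le_best: "hindsight_optimum B T v \<le> best {1..T} B v"
proof -
  have "(\<Sum>t=1..T. v t * real (a t)) \<le> best {1..T} B v" if a: "a \<in> feasible_actions B T" for a
  proof -
    define S where "S = {t \<in> {1..T}. a t = 1}"
    have 01: "a t = (if t \<in> S then 1 else 0)" if "t \<in> {1..T}" for t
      using a that by (auto simp: S_def feasible_actions_def PiE_iff)
    have "(\<Sum>t=1..T. v t * real (a t)) = (\<Sum>t=1..T. if t \<in> S then v t else 0)"
      using 01 by (intro sum.cong) auto
    also have "\<dots> = sum v S"
      by (subst sum.inter_restrict[symmetric]) (auto simp: S_def intro!: sum.cong)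
    also have "\<dots> \<le> best {1..T} B v"
    proof (rule sum_le_best)
      have "(\<Sum>t=1..T. a t) = (\<Sum>t=1..T. if t \<in> S then 1 else 0)"
        using 01 by (intro sum.cong) auto
      also have "\<dots> = card S"
        by (subst sum.inter_restrict[symmetric]) (auto simp: S_def intro!: arg_cong[where f = card])
      finally show "card S \<le> B" using a by (simp add: feasible_actions_def)
    qed (auto simp: S_def)
    finally show ?thesis .
  qed
  thus ?thesis
    unfolding hindsight_optimum_eq_Max using finite_feasible_actions feasible_actions_nonempty
    by (subst Max_le_iff) auto
qed

text \<open>
  An optimal set containing \<open>t\<close> can trade \<open>t\<close> for an element of \<open>A\<close> at least as valuable, as long as the
  other at most \<open>b - 1\<close> members do not already use up all such elements.
\<close>

lemma best_reject:
  assumes "finite A" "t \<notin> A" "v t \<le> 1"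
  shows "best (insert t A) b v \<le> best A b v + of_bool (card {s\<in>A. v t \<le> v s} < b)"
proof (rule best_le)
  fix S assume S: "S \<subseteq> insert t A" "card S \<le> b"
  have finS: "finite S" using S(1) assms(1) finite_subset by blast
  show "sum v S \<le> best A b v + of_bool (card {s\<in>A. v t \<le> v s} < b)"
  proof (cases "t \<in> S")
    case False
    hence "S \<subseteq> A" using S by blast
    thus ?thesis using sum_le_best[of A S b v] S assms(1) by auto
  next
    case True
    have card: "card (S - {t}) < b" "card (S - {t}) = card S - 1"
      using True finS S(2) card_gt_0_iff[of S] by auto
    have sum: "sum v S = v t + sum v (S - {t})"
      using True finS by (simp add: sum.remove)
    have SA: "S - {t} \<subseteq> A" using S(1) by blast
    show ?thesis
    proof (cases "card {s\<in>A. v t \<le> v s} < b")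
      case True
      have "sum v (S - {t}) \<le> best A b v"
        using SA card(1) assms(1) by (intro sum_le_best) auto
      thus ?thesis using True sum assms(3) by simp
    next
      case False
      hence "\<not> {s\<in>A. v t \<le> v s} \<subseteq> S - {t}"
        using card(1) card_mono[of "S - {t}" "{s\<in>A. v t \<le> v s}"] finS by auto
      then obtain s where s: "s \<in> A" "v t \<le> v s" "s \<notin> S" using assms(2) by auto
      have "sum v S \<le> v s + sum v (S - {t})" using sum s by simp
      also have "\<dots> = sum v (insert s (S - {t}))" using s finS by simp
      also have "\<dots> \<le> best A b v"
        using s S card finS assms(1) by (intro sum_le_best) auto
      finally show ?thesis by simp
    qed
  qed
qed (use assms in auto)

text \<open>
  An optimal set that avoids \<open>t\<close> and exhausts the budget contains an element not more valuable than
  \<open>t\<close>, unless all its \<open>b\<close> members are strictly better; that element can be replaced by \<open>t\<close>.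
\<close>

lemma best_accept:
  assumes "finite A" "t \<notin> A" "1 \<le> b" and v01: "\<And>s. s \<in> insert t A \<Longrightarrow> v s \<in> {0..1}"
  shows "best (insert t A) b v \<le> v t + best A (b - 1) v + of_bool (b \<le> card {s\<in>A. v t < v s})"
proof (rule best_le)
  fix S assume S: "S \<subseteq> insert t A" "card S \<le> b"
  have finS: "finite S" using S(1) assms(1) finite_subset by blast
  have remove: "sum v (S - {s}) \<le> best A (b - 1) v" if "s \<in> S" "S - {s} \<subseteq> A" for s
    using that finS S(2) assms(1) by (intro sum_le_best) auto
  have sum: "sum v S = v s + sum v (S - {s})" if "s \<in> S" for s
    using that finS by (simp add: sum.remove)
  show "sum v S \<le> v t + best A (b - 1) v + of_bool (b \<le> card {s\<in>A. v t < v s})"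
  proof (cases "t \<in> S")
    case True
    moreover have "S - {t} \<subseteq> A" using S by blast
    ultimately show ?thesis using remove[of t] sum[of t] by auto
  next
    case tS: False
    hence SA: "S \<subseteq> A" using S by auto
    show ?thesis
    proof (cases "card S \<le> b - 1")
      case True
      thus ?thesis using sum_le_best[OF assms(1) SA True, of v] v01[of t] by auto
    next
      case False
      hence cS: "card S = b" "S \<noteq> {}" using S(2) assms(3) by auto
      show ?thesis
      proof (cases "b \<le> card {s\<in>A. v t < v s}")
        case True
        obtain s where s: "s \<in> S" using cS by auto
        hence "S - {s} \<subseteq> A" "v s \<le> 1" "0 \<le> v t" using SA v01[of s] v01[of t] by auto
        thus ?thesis using sum[OF s] remove[OF s] True by simp
      next
        case False
        hence "\<not> S \<subseteq> {s\<in>A. v t < v s}"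
          using cS card_mono[of "{s\<in>A. v t < v s}" S] assms(1) by auto
        then obtain s where s: "s \<in> S" "v s \<le> v t" using SA by force
        moreover have "S - {s} \<subseteq> A" using SA by blast
        ultimately show ?thesis using sum[of s] remove[of s] by simp
      qed
    qed
  qed
qed (use assms in auto)

text \<open>
  If \<open>U\<close> consists of the most valuable elements, then some value \<open>w \<le> 1\<close> separates \<open>U\<close> from the rest.
  Every element by which a competitor exceeds \<open>U\<close> in size gains at most \<open>w\<close>.
\<close>

lemma best_upper_set:
  assumes "finite A" "U \<subseteq> A" and v01: "\<And>s. s \<in> A \<Longrightarrow> v s \<in> {0..1}"
    and upper: "\<And>s r. s \<in> U \<Longrightarrow> r \<in> A - U \<Longrightarrow> v r \<le> v s"
  shows "best A b v \<le> sum v U + max 0 (real (min b (card A)) - real (card U))"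
proof (rule best_le)
  fix S assume S: "S \<subseteq> A" "card S \<le> b"
  have fin: "finite S" "finite U" using S(1) assms(1,2) finite_subset by blast+
  obtain w where w: "0 \<le> w" "w \<le> 1" "\<And>s. s \<in> U \<Longrightarrow> w \<le> v s" "\<And>r. r \<in> A - U \<Longrightarrow> v r \<le> w"
  proof (cases "U = {}")
    case True
    \<comment> \<open>With nothing in \<open>U\<close> the separating value only has to dominate all abilities.\<close>
    thus ?thesis using that[of 1] v01 by auto
  next
    case False
    have "Min (v ` U) \<in> v ` U" using False fin by (intro Min_in) auto
    then obtain u where u: "u \<in> U" "Min (v ` U) = v u" by auto
    show ?thesis
    proof (rule that[of "v u"])
      have "v u \<le> v s" if "s \<in> U" for s using Min_le[of "v ` U" "v s"] that fin u by auto
      thus "v u \<le> v s" if "s \<in> U" for s using that .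
      show "0 \<le> v u" "v u \<le> 1" using v01[of u] u(1) assms(2) by auto
      show "v r \<le> v u" if "r \<in> A - U" for r using upper[OF u(1) that] .
    qed
  qed
  have card: "real (card S) \<le> real (min b (card A))"
    using S card_mono[OF assms(1) S(1)] by simp
  have cs: "real (card (S - U)) - real (card (U - S)) = real (card S) - real (card U)"
    using card_Diff_subset_Int[of S U] card_Diff_subset_Int[of U S] fin
      card_mono[of S "S \<inter> U"] card_mono[of U "S \<inter> U"] by (simp add: Int_commute of_nat_diff)
  have "sum v S = sum v (S \<inter> U) + sum v (S - U)" using fin by (simp add: sum.Int_Diff)
  moreover have "sum v U = sum v (S \<inter> U) + sum v (U - S)"
    using fin by (subst sum.Int_Diff[of U _ S]) (simp_all add: Int_commute)
  moreover have "sum v (S - U) \<le> w * real (card (S - U))"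
    using sum_bounded_above[of "S - U" v w] w(4) S(1) by (auto simp: mult.commute)
  moreover have "w * real (card (U - S)) \<le> sum v (U - S)"
    using sum_bounded_below[of "U - S" w v] w(3) by (auto simp: mult.commute)
  ultimately have "sum v S \<le> sum v U + w * (real (card S) - real (card U))"
    using cs by (simp add: algebra_simps flip: cs)
  also have "w * (real (card S) - real (card U)) \<le> w * max 0 (real (min b (card A)) - real (card U))"
    using card w by (intro mult_left_mono) auto
  also have "\<dots> \<le> max 0 (real (min b (card A)) - real (card U))"
    using w by (intro mult_left_le_one_le) auto
  finally show "sum v S \<le> sum v U + max 0 (real (min b (card A)) - real (card U))" by simp
qed (use assms in auto)

section \<open>Sample path properties of the policy\<close>

lemma cwg_budget_1: "cwg_budget m p T B sel \<omega> (Suc 0) = B"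
  by (subst cwg_budget.simps) simp

text \<open>
  Non-anticipation of the policy, including the second phase, whose threshold is fixed by the budget at
  its first period.
\<close>

lemma cwg_depends_on_past:
  assumes "\<And>s. s < t \<Longrightarrow> \<omega> s = \<omega>' s"
  shows "cwg_budget m p T B sel \<omega> t = cwg_budget m p T B sel \<omega>' t \<and>
         cwg_threshold m p T B sel \<omega> t = cwg_threshold m p T B sel \<omega>' t"
  using assms
proof (induction t rule: less_induct)
  case (less t)
  have IH: "cwg_budget m p T B sel \<omega> s = cwg_budget m p T B sel \<omega>' s"
           "cwg_threshold m p T B sel \<omega> s = cwg_threshold m p T B sel \<omega>' s" if "s < t" for s
    using less.IH[OF that] less.prems that by auto
  have b: "cwg_budget m p T B sel \<omega> t = cwg_budget m p T B sel \<omega>' t"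
  proof (cases "t \<le> 1")
    case False
    hence "t - 1 < t" by simp
    thus ?thesis using IH[of "t - 1"] less.prems[of "t - 1"]
      by (subst (1 2) cwg_budget.simps) simp
  qed (simp add: cwg_budget.simps)
  moreover have "phase1_length m p T + 1 < t \<or> phase1_length m p T + 1 = t"
    if "\<not> t \<le> phase1_length m p T" using that by linarith
  ultimately have "cwg_threshold m p T B sel \<omega> t = cwg_threshold m p T B sel \<omega>' t"
    using IH(1)[of "phase1_length m p T + 1"]
    by (subst (1 2) cwg_threshold.simps) auto
  with b show ?case by simp
qed

text \<open>
  A candidate above the threshold is turned away only when the budget is exhausted. If this ever
  happens, the second phase has accepted exactly as many candidates as the budget it started with, and
  the remaining elements of \<open>K\<close> are the rejected ones.
\<close>

lemma cwg_second_phase_rejections: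
  fixes m :: nat and p :: "nat \<Rightarrow> real" and T B :: nat and sel \<omega>
  defines "L \<equiv> phase1_length m p T"
  defines "K \<equiv> {t \<in> {L+1..T}. cwg_threshold m p T B sel \<omega> t \<le> aux \<omega> t}"
  assumes "L \<le> T"
  shows "real (card {t\<in>K. cwg m p T B sel \<omega> t = 0})
      \<le> max 0 (real (card K) - real (cwg_budget m p T B sel \<omega> (L + 1)))"
proof (cases "{t\<in>K. cwg m p T B sel \<omega> t = 0} = {}")
  case False
  let ?b = "cwg_budget m p T B sel \<omega>"
  let ?a = "cwg m p T B sel \<omega>"
  have anti: "?b (Suc s) \<le> ?b (Suc r)" if "r \<le> s" for r s
    using that
  proof (induction s rule: dec_induct)
    case (step n)
    thus ?case using cwg_budget_Suc[of "Suc n" m p T B sel \<omega>] by simp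
  qed simp
  obtain t where t: "t \<in> K" "?a t = 0" using False by auto
  hence "?b t = 0" by (auto simp: K_def cwg_def split: if_splits)
  hence "?b (Suc T) = 0" using t anti[of "t - 1" T] by (auto simp: K_def)
  hence "(\<Sum>t=1..T. ?a t) = B"
    using cwg_budget_add_sum[of m p T B sel \<omega> T] by simp
  moreover have "?b (Suc L) + (\<Sum>t=1..L. ?a t) = B"
    by (rule cwg_budget_add_sum)
  moreover have "(\<Sum>t=1..T. ?a t) = (\<Sum>t=1..L. ?a t) + (\<Sum>t=L+1..T. ?a t)"
    using sum.ub_add_nat[of 1 L ?a "T - L"] assms(3) by simp
  ultimately have "(\<Sum>t=L+1..T. ?a t) = ?b (Suc L)" by linarith
  also have "(\<Sum>t=L+1..T. ?a t) = (\<Sum>t=L+1..T. if t \<in> {t\<in>K. ?a t = 1} then 1 else 0)"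
    by (intro sum.cong) (auto simp: K_def cwg_def)
  also have "\<dots> = card {t\<in>K. ?a t = 1}"
    by (subst sum.inter_restrict[symmetric]) (auto simp: K_def intro!: arg_cong[where f=card])
  finally have "card {t\<in>K. ?a t = 1} = ?b (Suc L)" .
  moreover have "card ({t\<in>K. ?a t = 1} \<union> {t\<in>K. ?a t = 0}) = card {t\<in>K. ?a t = 1} + card {t\<in>K. ?a t = 0}"
    by (intro card_Un_disjoint) (auto simp: K_def)
  moreover have "{t\<in>K. ?a t = 1} \<union> {t\<in>K. ?a t = 0} = K" by (auto simp: cwg_def)
  ultimately show ?thesis by simp
next
  case True
  hence "card {t\<in>K. cwg m p T B sel \<omega> t = 0} = 0" by (simp only: card.empty)
  thus ?thesis by simp
qed

section \<open>The law of a candidate\<close>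

locale discrete_abilities =
  fixes m :: nat and \<theta> p :: "nat \<Rightarrow> real" and F :: "real pmf"
  assumes m_ge_1: "1 \<le> m"
    and strict_mono_\<theta>: "strict_mono_on {1..m} \<theta>"
    and \<theta>_range: "\<theta> ` {1..m} \<subseteq> {0..1}"
    and set_pmf_F: "set_pmf F = \<theta> ` {1..m}"
    and pmf_F: "\<And>i. i \<in> {1..m} \<Longrightarrow> pmf F (\<theta> i) = p i"
    and p_pos: "\<And>i. i \<in> {1..m} \<Longrightarrow> 0 < p i"
begin

abbreviation q :: "nat \<Rightarrow> real" where "q \<equiv> gap_quantile p"
abbreviation \<epsilon> :: real where "\<epsilon> \<equiv> min_mass m p"

lemma \<theta>_less: "i \<in> {1..m} \<Longrightarrow> j \<in> {1..m} \<Longrightarrow> i < j \<Longrightarrow> \<theta> i < \<theta> j"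
  using strict_mono_\<theta> by (auto simp: strict_mono_on_def)

lemma \<theta>_less_iff: "i \<in> {1..m} \<Longrightarrow> j \<in> {1..m} \<Longrightarrow> \<theta> i < \<theta> j \<longleftrightarrow> i < j"
  using \<theta>_less[of i j] \<theta>_less[of j i] by (cases i j rule: linorder_cases) auto

lemma inj_\<theta>: "inj_on \<theta> {1..m}"
  using strict_mono_\<theta> strict_mono_on_imp_inj_on by blast

lemma \<theta>_01: "i \<in> {1..m} \<Longrightarrow> \<theta> i \<in> {0..1}"
  using \<theta>_range by blast

lemma q_0 [simp]: "q 0 = 0" by (simp add: gap_quantile_def)

lemma q_Suc: "q (Suc i) = q i + p (Suc i)" by (simp add: gap_quantile_def)

lemma q_m [simp]: "q m = 1"
proof -
  have "q m = (\<Sum>i=1..m. pmf F (\<theta> i))" by (simp add: gap_quantile_def pmf_F)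
  also have "\<dots> = sum (pmf F) (set_pmf F)"
    using inj_\<theta> by (simp add: set_pmf_F sum.reindex)
  also have "\<dots> = 1" by (intro sum_pmf_eq_1) (auto simp: set_pmf_F)
  finally show ?thesis .
qed

lemma \<epsilon>_le: "i \<in> {1..m} \<Longrightarrow> \<epsilon> \<le> p i"
  unfolding min_mass_def by (intro Min_le) auto

lemma \<epsilon>_pos: "0 < \<epsilon>"
  unfolding min_mass_def using m_ge_1 p_pos by (subst Min_gr_iff) auto

lemma m_mult_\<epsilon>_le_1: "real m * \<epsilon> \<le> 1"
proof -
  have "real m * \<epsilon> = (\<Sum>i=1..m. \<epsilon>)" by simp
  also have "\<dots> \<le> q m" unfolding gap_quantile_def by (intro sum_mono \<epsilon>_le) auto
  finally show ?thesis by simp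
qed

lemma q_gap: "i < j \<Longrightarrow> j \<le> m \<Longrightarrow> q i + \<epsilon> \<le> q j"
proof (induction j rule: less_induct)
  case (less j)
  then obtain j' where j: "j = Suc j'" by (cases j) auto
  have "\<epsilon> \<le> p (Suc j')" using less j by (intro \<epsilon>_le) auto
  moreover have "q i \<le> q j'"
  proof (cases "i = j'")
    case False
    hence "q i + \<epsilon> \<le> q j'" using less j by (intro less.IH) auto
    thus ?thesis using \<epsilon>_pos by simp
  qed simp
  ultimately show ?case using j by (simp add: q_Suc)
qed

lemma q_less: "i < j \<Longrightarrow> j \<le> m \<Longrightarrow> q i < q j"
  using q_gap[of i j] \<epsilon>_pos by simp

lemma q_le: "i \<le> j \<Longrightarrow> j \<le> m \<Longrightarrow> q i \<le> q j"
  using q_less[of i j] by (cases "i = j") auto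

lemma q_less_iff: "i \<le> m \<Longrightarrow> j \<le> m \<Longrightarrow> q i < q j \<longleftrightarrow> i < j"
  using q_less[of i j] q_le[of j i] by (cases "i < j") auto

lemma q_01: "i \<le> m \<Longrightarrow> q i \<in> {0..1}"
  using q_le[of 0 i] q_le[of i m] by auto

lemma p_eq_diff: "i \<in> {1..m} \<Longrightarrow> p i = q i - q (i - 1)"
  using q_Suc[of "i - 1"] by auto

lemma prob_atoms: "measure F (\<theta> ` {1..i}) = q i" if "i \<le> m"
proof -
  have "measure F (\<theta> ` {1..i}) = (\<Sum>x\<in>\<theta> ` {1..i}. pmf F x)"
    by (intro measure_measure_pmf_finite) auto
  also have "\<dots> = (\<Sum>j=1..i. pmf F (\<theta> j))"
    using that by (intro sum.reindex_cong[OF inj_on_subset[OF inj_\<theta>]]) auto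
  finally show ?thesis using that by (simp add: gap_quantile_def pmf_F)
qed

lemma cdf_atom:
  assumes "i \<in> {1..m}" shows "cdf F (\<theta> i) = q i"
proof -
  have "j \<le> i" if "j \<in> {1..m}" "\<theta> j \<le> \<theta> i" for j
    using \<theta>_less_iff[of i j] assms that by auto
  moreover have "\<theta> j \<le> \<theta> i" if "j \<in> {1..i}" for j
    using \<theta>_less_iff[of i j] assms that by force
  ultimately have "{..\<theta> i} \<inter> set_pmf F = \<theta> ` {1..i}" using assms
    by (auto simp: set_pmf_F)
  thus ?thesis using prob_atoms[of i] assms
    by (metis atLeastAtMost_iff cdf_def measure_Int_set_pmf)
qed

lemma cdf_below_atom:
  assumes "i \<in> {1..m}" "v < \<theta> i" shows "cdf F v \<le> q (i - 1)"
proof -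
  have "j \<in> {1..i-1}" if "j \<in> {1..m}" "\<theta> j \<le> v" for j
    using \<theta>_less_iff[of j i] assms that by auto
  hence "{..v} \<inter> set_pmf F \<subseteq> \<theta> ` {1..i-1}"
    by (auto simp: set_pmf_F)
  hence "measure F ({..v} \<inter> set_pmf F) \<le> measure F (\<theta> ` {1..i-1})"
    by (intro measure_pmf.finite_measure_mono) auto
  also have "\<dots> = q (i - 1)" using assms by (intro prob_atoms) auto
  finally show ?thesis by (simp add: cdf_def measure_Int_set_pmf)
qed

lemma quantile_eq_atom:
  assumes i: "i \<in> {1..m}" and x: "q (i - 1) < x" "x \<le> q i"
  shows "quantile F x = \<theta> i"
  unfolding quantile_def
proof (rule cInf_eq_minimum)
  show "\<theta> i \<in> {v \<in> {0..1}. x \<le> cdf F v}"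
    using i x \<theta>_01[OF i] by (auto simp: cdf_atom)
next
  fix v assume "v \<in> {v \<in> {0..1}. x \<le> cdf F v}"
  thus "\<theta> i \<le> v" using cdf_below_atom[OF i, of v] x by (cases "v < \<theta> i") auto
qed

lemma atom_of_quantile_level:
  assumes "x \<in> {0<..1}"
  shows "\<exists>i\<in>{1..m}. q (i - 1) < x \<and> x \<le> q i"
proof -
  define i where "i = (LEAST i. x \<le> q i)"
  have m: "x \<le> q m" using assms by simp
  hence i: "x \<le> q i" "i \<le> m" unfolding i_def by (rule LeastI, rule Least_le)
  have "i \<noteq> 0" using i assms by (cases "i = 0") auto
  moreover have "\<not> x \<le> q (i - 1)"
    using \<open>i \<noteq> 0\<close> not_less_Least[of "i - 1" "\<lambda>i. x \<le> q i"] by (auto simp: i_def)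
  ultimately show ?thesis using i by (intro bexI[of _ i]) auto
qed

text \<open>
  The level \<open>0\<close> is removed from the fibers: there the quantile is \<open>0\<close>, which may or may not be the
  lowest atom. As a null set it does not influence the uniform distributions.
\<close>

lemma quantile_fiber_atom:
  assumes i: "i \<in> {1..m}"
  shows "quantile_fiber F (\<theta> i) - {0} = {q (i - 1)<..q i}"
proof (intro equalityI subsetI)
  fix x assume "x \<in> quantile_fiber F (\<theta> i) - {0}"
  hence x: "x \<in> {0<..1}" "quantile F x = \<theta> i" by (auto simp: quantile_fiber_def)
  obtain j where j: "j \<in> {1..m}" "q (j - 1) < x" "x \<le> q j"
    using atom_of_quantile_level[OF x(1)] by blast
  have "j = i" using quantile_eq_atom[OF j] x(2) inj_\<theta> i j(1) by (auto dest: inj_onD)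
  thus "x \<in> {q (i - 1)<..q i}" using j by auto
next
  fix x assume "x \<in> {q (i - 1)<..q i}"
  moreover have "0 \<le> q (i - 1)" "q i \<le> 1" using q_01[of "i-1"] q_01[of i] i by auto
  ultimately show "x \<in> quantile_fiber F (\<theta> i) - {0}"
    using quantile_eq_atom[OF i, of x] by (auto simp: quantile_fiber_def)
qed

lemma quantile_fiber_non_atom:
  assumes "v \<notin> \<theta> ` {1..m}"
  shows "quantile_fiber F v - {0} = {}"
proof -
  have "x \<notin> quantile_fiber F v - {0}" for x
  proof
    assume "x \<in> quantile_fiber F v - {0}"
    hence x: "x \<in> {0<..1}" "quantile F x = v" by (auto simp: quantile_fiber_def)
    then obtain i where "i \<in> {1..m}" "q (i - 1) < x" "x \<le> q i"
      using atom_of_quantile_level by blast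
    thus False using quantile_eq_atom[of i x] x(2) assms by blast
  qed
  thus ?thesis by blast
qed

lemma sets_quantile_fiber [measurable]: "quantile_fiber F v \<in> sets borel"
proof -
  have "quantile_fiber F v - {0} \<in> sets borel"
  proof (cases "v \<in> \<theta> ` {1..m}")
    case True
    then obtain i where "i \<in> {1..m}" "v = \<theta> i" by auto
    thus ?thesis by (simp only: quantile_fiber_atom) simp
  next
    case False
    show ?thesis unfolding quantile_fiber_non_atom[OF False] by simp
  qed
  moreover have "quantile_fiber F v = (quantile_fiber F v - {0}) \<union> (quantile_fiber F v \<inter> {0})"
    by auto
  moreover have "quantile_fiber F v \<inter> {0} \<in> sets borel"
    by (cases "0 \<in> quantile_fiber F v") auto
  ultimately show ?thesis by (metis sets.Un)
qed

lemma emeasure_quantile_fiber: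
  assumes i: "i \<in> {1..m}" and [measurable]: "A \<in> sets borel"
  shows "emeasure lborel (quantile_fiber F (\<theta> i) \<inter> A) = emeasure lborel ({q (i - 1)<..q i} \<inter> A)"
proof -
  have "AE x in lborel. x \<notin> {0::real}"
    by (intro AE_not_in) (simp add: null_sets_def)
  hence "AE x in lborel. x \<in> quantile_fiber F (\<theta> i) \<inter> A \<longleftrightarrow> x \<in> {q (i - 1)<..q i} \<inter> A"
    by eventually_elim (use quantile_fiber_atom[OF i, unfolded set_eq_iff] in auto)
  thus ?thesis by (intro emeasure_eq_AE) auto
qed

lemma emeasure_quantile_fiber_total:
  assumes i: "i \<in> {1..m}"
  shows "emeasure lborel (quantile_fiber F (\<theta> i)) = ennreal (p i)"
  using emeasure_quantile_fiber[OF i, of UNIV] q_le[of "i - 1" i] i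
  by (simp add: p_eq_diff)

definition kernel :: "real \<Rightarrow> (real \<times> real) measure" where
  "kernel v = distr (uniform_measure lborel (quantile_fiber F v)) borel (Pair v)"

lemma prob_space_uniform_fiber:
  assumes "i \<in> {1..m}"
  shows "prob_space (uniform_measure lborel (quantile_fiber F (\<theta> i)))"
  using p_pos[OF assms] emeasure_quantile_fiber_total[OF assms]
  by (intro prob_space_uniform_measure) (auto simp: ennreal_eq_0_iff)

lemma measurable_fst_snd_borel [measurable]:
  "(fst :: real \<times> real \<Rightarrow> real) \<in> borel_measurable borel"
  "(snd :: real \<times> real \<Rightarrow> real) \<in> borel_measurable borel"
  by (intro borel_measurable_continuous_onI continuous_intros)+

lemma measurable_Pair_borel [measurable]: "Pair (v::real) \<in> (borel :: real measure) \<rightarrow>\<^sub>M borel"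
  unfolding borel_prod[symmetric] by simp

lemma prob_space_kernel: "i \<in> {1..m} \<Longrightarrow> prob_space (kernel (\<theta> i))"
  unfolding kernel_def by (intro prob_space.prob_space_distr prob_space_uniform_fiber) auto

text \<open>
  Off the atoms, the fiber is a null set and the uniform measure on it is the zero measure. The kernel
  is thus only a sub-probability kernel, but it is a probability measure almost surely.
\<close>

lemma measurable_kernel [measurable]: "kernel \<in> F \<rightarrow>\<^sub>M subprob_algebra borel"
proof -
  have "subprob_space (uniform_measure lborel (quantile_fiber F v))" for v
  proof (cases "v \<in> \<theta> ` {1..m}")
    case True
    thus ?thesis using prob_space_uniform_fiber by (auto intro: prob_space_imp_subprob_space)
  next
    case False
    have "AE x in lborel. x \<notin> {0::real}"
      by (intro AE_not_in) (simp add: null_sets_def)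
    hence "AE x in lborel. x \<notin> quantile_fiber F v"
      by eventually_elim (use quantile_fiber_non_atom[OF False] in auto)
    hence "emeasure lborel (quantile_fiber F v) = 0"
      by (subst (asm) AE_iff_measurable[where N = "quantile_fiber F v"]) auto
    thus ?thesis
      by (intro subprob_spaceI) (auto simp: emeasure_uniform_measure)
  qed
  hence "subprob_space (kernel v)" for v
    unfolding kernel_def by (intro subprob_space.subprob_space_distr) auto
  thus ?thesis by (auto simp: space_subprob_algebra kernel_def)
qed

lemma candidate_eq: "candidate F = measure_pmf F \<bind> kernel"
  unfolding candidate_def kernel_def[abs_def] ..

lemma sets_candidate [simp, measurable_cong]: "sets (candidate F) = sets borel"
  unfolding candidate_eq by (intro sets_bind) (auto simp: kernel_def)

lemma space_candidate [simp]: "space (candidate F) = UNIV"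
  using sets_eq_imp_space_eq[OF sets_candidate] by simp

lemma AE_F: "(AE v in F. P v) \<longleftrightarrow> (\<forall>i\<in>{1..m}. P (\<theta> i))"
  by (simp add: AE_measure_pmf_iff set_pmf_F)

lemma prob_space_candidate: "prob_space (candidate F)"
  unfolding candidate_eq
  by (rule measure_pmf.prob_space_bind[OF _ measurable_kernel]) (simp add: AE_F prob_space_kernel)

text \<open>
  Both inequalities are strict almost surely. So a candidate of type \<open>i\<close> is accepted at the threshold
  \<open>q i\<close> with probability zero.
\<close>

lemma AE_candidate:
  "AE y in candidate F. \<exists>i\<in>{1..m}. fst y = \<theta> i \<and> q (i - 1) < snd y \<and> snd y < q i"
  unfolding candidate_eq
proof (subst AE_bind[OF measurable_kernel], unfold AE_F, safe)
  fix i assume i: "i \<in> {1..m}"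
  have "AE x in lborel. x \<notin> {0, q i}"
    by (intro AE_not_in finite_imp_null_set_lborel) auto
  hence "AE x in lborel. x \<in> quantile_fiber F (\<theta> i) \<longrightarrow> q (i - 1) < x \<and> x < q i"
  proof eventually_elim
    case (elim x)
    have "x \<in> quantile_fiber F (\<theta> i) - {0} \<longleftrightarrow> x \<in> {q (i - 1)<..q i}"
      by (simp only: quantile_fiber_atom[OF i])
    thus ?case using elim by auto
  qed
  hence "AE x in uniform_measure lborel (quantile_fiber F (\<theta> i)). q (i - 1) < x \<and> x < q i"
    by (intro AE_uniform_measureI) auto
  hence "AE x in uniform_measure lborel (quantile_fiber F (\<theta> i)).
     \<exists>j\<in>{1..m}. \<theta> i = \<theta> j \<and> q (j - 1) < x \<and> x < q j"
    by eventually_elim (use i in auto)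
  thus "AE y in kernel (\<theta> i). \<exists>j\<in>{1..m}. fst y = \<theta> j \<and> q (j - 1) < snd y \<and> snd y < q j"
    unfolding kernel_def by (subst AE_distr_iff) auto
qed simp

text \<open>
  The auxiliary variable is uniform on \<open>[0,1]\<close>: weighting the uniform distribution on the fiber of
  \<open>\<theta> i\<close> with its length \<open>p i\<close> restores Lebesgue measure, and the contributions telescope.
\<close>

lemma prob_aux_ge:
  assumes c: "c \<in> {0..1}"
  shows "measure (candidate F) {y. c \<le> snd y} = 1 - c"
proof -
  have "{y \<in> space borel. c \<le> snd y} \<in> sets (borel :: (real \<times> real) measure)"
    by measurable
  hence [measurable]: "{y::real \<times> real. c \<le> snd y} \<in> sets borel" by simp
  have kern: "p i * measure (kernel (\<theta> i)) {y. c \<le> snd y} = max c (q i) - max c (q (i - 1))"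
    if i: "i \<in> {1..m}" for i
  proof -
    have "emeasure (kernel (\<theta> i)) {y. c \<le> snd y}
        = emeasure (uniform_measure lborel (quantile_fiber F (\<theta> i))) {c..}"
    proof -
      have "Pair (\<theta> i) -` {y. c \<le> snd y} = {c..}" by auto
      thus ?thesis unfolding kernel_def by (subst emeasure_distr) simp_all
    qed
    also have "\<dots> = emeasure lborel (quantile_fiber F (\<theta> i) \<inter> {c..}) / ennreal (p i)"
      by (subst emeasure_uniform_measure) (auto simp: emeasure_quantile_fiber_total[OF i])
    also have "\<dots> = emeasure lborel ({q (i - 1)<..q i} \<inter> {c..}) / ennreal (p i)"
      by (simp add: emeasure_quantile_fiber[OF i])
    also have "emeasure lborel ({q (i - 1)<..q i} \<inter> {c..}) = emeasure lborel {max c (q (i - 1))<..max c (q i)}"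
    proof (rule emeasure_eq_AE)
      have "AE x in lborel. x \<notin> {c}" by (intro AE_not_in finite_imp_null_set_lborel) auto
      thus "AE x in lborel. x \<in> {q (i - 1)<..q i} \<inter> {c..} \<longleftrightarrow> x \<in> {max c (q (i - 1))<..max c (q i)}"
        by eventually_elim auto
    qed auto
    also have "\<dots> = ennreal (max c (q i) - max c (q (i - 1)))"
      using q_le[of "i - 1" i] i by (subst emeasure_lborel_Ioc) auto
    also have "\<dots> / ennreal (p i) = ennreal ((max c (q i) - max c (q (i - 1))) / p i)"
      using q_le[of "i - 1" i] i p_pos[OF i] by (intro divide_ennreal) auto
    finally show ?thesis using q_le[of "i - 1" i] i p_pos[OF i]
      by (simp add: measure_def)
  qed
  have "measure (candidate F) {y. c \<le> snd y} = (\<integral>v. measure (kernel v) {y. c \<le> snd y} \<partial>F)"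
    unfolding candidate_eq by (rule measure_pmf.measure_bind[OF measurable_kernel]) simp
  also have "\<dots> = (\<Sum>v\<in>\<theta> ` {1..m}. measure (kernel v) {y. c \<le> snd y} * pmf F v)"
    by (intro integral_measure_pmf_real) (auto simp: set_pmf_F)
  also have "\<dots> = (\<Sum>i=1..m. p i * measure (kernel (\<theta> i)) {y. c \<le> snd y})"
    using inj_\<theta> by (simp add: sum.reindex pmf_F mult.commute)
  also have "\<dots> = (\<Sum>i=1..m. max c (q i) - max c (q (i - 1)))"
    by (intro sum.cong kern) auto
  also have "\<dots> = (\<Sum>i<m. max c (q (Suc i)) - max c (q i))"
    by (rule sum.reindex_bij_witness[of _ Suc "\<lambda>i. i - 1"]) auto
  also have "\<dots> = max c (q m) - max c (q 0)" by (rule sum_lessThan_telescope)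
  also have "\<dots> = 1 - c" using c by simp
  finally show ?thesis .
qed

end

section \<open>Regret along a sample path\<close>

locale cwg_policy = discrete_abilities +
  fixes T B :: nat and sel :: "nat \<Rightarrow> nat \<Rightarrow> nat"
  assumes sel: "nearest_gap_selection m p T sel"
begin

abbreviation L :: nat where "L \<equiv> phase1_length m p T"

abbreviation budget :: "(nat \<Rightarrow> real \<times> real) \<Rightarrow> nat \<Rightarrow> nat" where
  "budget \<omega> t \<equiv> cwg_budget m p T B sel \<omega> t"

abbreviation action :: "(nat \<Rightarrow> real \<times> real) \<Rightarrow> nat \<Rightarrow> nat" where
  "action \<omega> t \<equiv> cwg m p T B sel \<omega> t"

definition remaining :: "nat \<Rightarrow> real" where
  "remaining t = real T - real t + 1"

definition radius :: "nat \<Rightarrow> real" where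
  "radius t = sqrt (2 * ln (remaining t) / remaining t)"

text \<open>
  On the almost sure event \<open>regular\<close>, comparisons between abilities become comparisons of the uniform
  variables with gap quantiles.
\<close>

definition regular :: "(nat \<Rightarrow> real \<times> real) \<Rightarrow> bool" where
  "regular \<omega> \<longleftrightarrow> (\<forall>t\<in>{1..T}. \<exists>i\<in>{1..m}.
     ability \<omega> t = \<theta> i \<and> q (i - 1) < aux \<omega> t \<and> aux \<omega> t < q i)"

definition count_above :: "real \<Rightarrow> nat \<Rightarrow> (nat \<Rightarrow> real \<times> real) \<Rightarrow> nat" where
  "count_above c t \<omega> = card {s \<in> {t+1..T}. c \<le> aux \<omega> s}"

text \<open>
  This event concerns the periods after \<open>t\<close> only and mentions neither the budget nor the threshold in use.
\<close>

definition concentrated :: "nat \<Rightarrow> (nat \<Rightarrow> real \<times> real) \<Rightarrow> bool" where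
  "concentrated t \<omega> \<longleftrightarrow> (\<forall>k\<in>{1..m-1}.
     \<bar>real (count_above (q k) t \<omega>) - (remaining t - 1) * (1 - q k)\<bar> < remaining t * radius t - 1)"

lemma regular_cases:
  assumes "regular \<omega>" "t \<in> {1..T}"
  obtains i where "i \<in> {1..m}" "ability \<omega> t = \<theta> i" "q (i - 1) < aux \<omega> t" "aux \<omega> t < q i"
  using assms unfolding regular_def by blast

lemma regular_01: "regular \<omega> \<Longrightarrow> t \<in> {1..T} \<Longrightarrow> ability \<omega> t \<in> {0..1}"
  using \<theta>_01 by (metis regular_cases)

lemma regular_aux_pos:
  assumes "regular \<omega>" "t \<in> {1..T}"
  shows "0 < aux \<omega> t"
proof -
  obtain i where i: "i \<in> {1..m}" "q (i - 1) < aux \<omega> t" using assms by (rule regular_cases)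
  have "0 \<le> q (i - 1)" using q_01[of "i - 1"] i by auto
  thus ?thesis using i by simp
qed

lemma regular_greater_iff:
  assumes "regular \<omega>" "t \<in> {1..T}" "i \<in> {1..m}"
  shows "\<theta> i < ability \<omega> t \<longleftrightarrow> q i \<le> aux \<omega> t"
proof -
  obtain j where j: "j \<in> {1..m}" "ability \<omega> t = \<theta> j" "q (j - 1) < aux \<omega> t" "aux \<omega> t < q j"
    using assms(1,2) by (rule regular_cases)
  show ?thesis
  proof (cases "i < j")
    case True
    hence "q i \<le> q (j - 1)" using j by (intro q_le) auto
    thus ?thesis using True j \<theta>_less_iff[OF assms(3) j(1)] by simp
  next
    case False
    hence "q j \<le> q i" using assms(3) by (intro q_le) auto
    thus ?thesis using False j \<theta>_less_iff[OF assms(3) j(1)] by simp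
  qed
qed

lemma regular_ge_iff:
  assumes "regular \<omega>" "t \<in> {1..T}" "i \<in> {1..m}"
  shows "\<theta> i \<le> ability \<omega> t \<longleftrightarrow> q (i - 1) \<le> aux \<omega> t"
proof -
  obtain j where j: "j \<in> {1..m}" "ability \<omega> t = \<theta> j" "q (j - 1) < aux \<omega> t" "aux \<omega> t < q j"
    using assms(1,2) by (rule regular_cases)
  show ?thesis
  proof (cases "i \<le> j")
    case True
    hence "q (i - 1) \<le> q (j - 1)" using j by (intro q_le) auto
    thus ?thesis using True j \<theta>_less_iff[OF j(1) assms(3)] by simp
  next
    case False
    hence "q j \<le> q (i - 1)" using assms(3) by (intro q_le) auto
    thus ?thesis using False j \<theta>_less_iff[OF j(1) assms(3)] by simp
  qed
qed

lemma regular_mono: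
  assumes "regular \<omega>" "s \<in> {1..T}" "t \<in> {1..T}" "aux \<omega> s \<le> aux \<omega> t"
  shows "ability \<omega> s \<le> ability \<omega> t"
proof -
  obtain i where i: "i \<in> {1..m}" "ability \<omega> s = \<theta> i" "q (i - 1) < aux \<omega> s" "aux \<omega> s < q i"
    using assms(1,2) by (rule regular_cases)
  show ?thesis using regular_ge_iff[OF assms(1,3) i(1)] i assms(4) by simp
qed

lemma remaining_mult_p_CE:
  "t \<in> {1..T} \<Longrightarrow> real b = remaining t * (1 - p_CE T t b)"
  by (auto simp: p_CE_def remaining_def)

text \<open>
  Only the separation of the certainty-equivalent level \<open>p_CE\<close> from the gap quantiles matters later. If
  no gap quantile is near, it holds by the definition of nearness. Otherwise the threshold is a gap
  quantile within the radius of \<open>p_CE\<close>, and every other one is at least \<open>\<epsilon> \<ge> 2 * radius t\<close> away from it.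
\<close>

lemma
  assumes t: "t \<in> {1..T}" and sep: "1 < m \<Longrightarrow> 2 * radius t \<le> \<epsilon>" and i: "i \<in> {1..m}"
  shows below_threshold: "q (i - 1) < p_CwG m p T sel t b \<Longrightarrow>
          q (i - 1) < p_CE T t b \<and> (i = 1 \<or> q (i - 1) + radius t \<le> p_CE T t b)"
    and above_threshold: "p_CwG m p T sel t b < q i \<Longrightarrow>
          i = m \<or> p_CE T t b + radius t \<le> q i"
proof -
  let ?\<tau> = "p_CwG m p T sel t b"
  have gaps: "near_gaps m p T t b = {i \<in> {1..m - 1}. \<bar>p_CE T t b - q i\<bar> \<le> radius t}"
    by (simp add: near_gaps_def radius_def remaining_def)
  have "(q (i - 1) < ?\<tau> \<longrightarrow> q (i - 1) < p_CE T t b \<and> (i = 1 \<or> q (i - 1) + radius t \<le> p_CE T t b))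
      \<and> (?\<tau> < q i \<longrightarrow> i = m \<or> p_CE T t b + radius t \<le> q i)"
  proof (cases "near_gaps m p T t b = {}")
    case True
    hence far: "radius t < \<bar>p_CE T t b - q k\<bar>" if "k \<in> {1..m-1}" for k
      using that unfolding gaps by fastforce
    have \<tau>: "?\<tau> = p_CE T t b" using True by (simp add: p_CwG_def)
    have "q (i - 1) + radius t \<le> p_CE T t b" if "i \<noteq> 1" "q (i - 1) < p_CE T t b"
    proof -
      have "i - 1 \<in> {1..m-1}" using i that by auto
      from far[OF this] that(2) show ?thesis by linarith
    qed
    moreover have "p_CE T t b + radius t \<le> q i" if "i \<noteq> m" "p_CE T t b < q i"
    proof -
      have "i \<in> {1..m-1}" using i that by auto
      from far[OF this] that(2) show ?thesis by linarith
    qed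
    ultimately show ?thesis unfolding \<tau> by blast
  next
    case False
    define j where "j = sel t b"
    have "j \<in> near_gaps m p T t b"
      using False sel t unfolding nearest_gap_selection_def j_def is_arg_min_def by blast
    hence j: "j \<in> {1..m-1}" "\<bar>p_CE T t b - q j\<bar> \<le> radius t" by (auto simp: gaps)
    have \<tau>: "?\<tau> = q j" using False by (simp add: p_CwG_def j_def)
    have r: "2 * radius t \<le> \<epsilon>" using j by (intro sep) auto
    have "q (i - 1) + \<epsilon> \<le> q j" if "q (i - 1) < q j"
      using that q_less_iff[of "i - 1" j] j i by (intro q_gap) auto
    moreover have "q j + \<epsilon> \<le> q i" if "q j < q i"
      using that q_less_iff[of j i] j i by (intro q_gap) auto
    ultimately show ?thesis using r j(2) \<epsilon>_pos unfolding \<tau> by argo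
  qed
  thus "q (i - 1) < ?\<tau> \<Longrightarrow>
          q (i - 1) < p_CE T t b \<and> (i = 1 \<or> q (i - 1) + radius t \<le> p_CE T t b)"
       "?\<tau> < q i \<Longrightarrow> i = m \<or> p_CE T t b + radius t \<le> q i" by blast+
qed

text \<open>
  A rejected candidate of type \<open>i\<close> has \<open>q (i - 1)\<close> below the threshold. Concentration, applied to the
  later candidates above \<open>q (i - 1)\<close>, that is, to those at least as good, shows that they exhaust the budget.
\<close>

lemma rejection_without_loss:
  assumes t: "t \<in> {1..T}" and sep: "1 < m \<Longrightarrow> 2 * radius t \<le> \<epsilon>"
    and reg: "regular \<omega>" and conc: "concentrated t \<omega>"
    and reject: "aux \<omega> t < p_CwG m p T sel t b"
  shows "b \<le> card {s\<in>{t+1..T}. ability \<omega> t \<le> ability \<omega> s}"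
proof -
  obtain i where i: "i \<in> {1..m}" "ability \<omega> t = \<theta> i" "q (i - 1) < aux \<omega> t" "aux \<omega> t < q i"
    using reg t by (rule regular_cases)
  have count: "card {s\<in>{t+1..T}. ability \<omega> t \<le> ability \<omega> s} = count_above (q (i - 1)) t \<omega>"
    unfolding count_above_def using regular_ge_iff[OF reg _ i(1)] i t
    by (intro arg_cong[where f = card]) auto
  have below: "q (i - 1) < p_CE T t b" "i = 1 \<or> q (i - 1) + radius t \<le> p_CE T t b"
    using below_threshold[OF t sep i(1), of b] i reject by auto
  have n: "remaining t \<ge> 1" using t by (auto simp: remaining_def)
  show ?thesis
  proof (cases "i = 1")
    case True
    \<comment> \<open>All later candidates are at least as good as the lowest type, and the positive level \<open>p_CE\<close>
      leaves a budget smaller than the number of remaining periods.\<close>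
    have "{s \<in> {t+1..T}. 0 \<le> aux \<omega> s} = {t+1..T}"
      using regular_aux_pos[OF reg] t by (fastforce intro: less_imp_le)
    hence "real (count_above (q (i - 1)) t \<omega>) = remaining t - 1"
      using True t by (simp add: count_above_def remaining_def of_nat_diff)
    moreover have "real b < remaining t * 1"
      using below(1) True n remaining_mult_p_CE[OF t, of b] by (simp add: mult_less_cancel_left_pos)
    ultimately show ?thesis using count by (simp add: remaining_def)
  next
    case False
    hence k: "i - 1 \<in> {1..m-1}" using i by auto
    have "real b \<le> remaining t * (1 - (q (i - 1) + radius t))"
      using below(2) False n unfolding remaining_mult_p_CE[OF t, of b]
      by (intro mult_left_mono) auto
    also have "\<dots> = (remaining t - 1) * (1 - q (i - 1)) + (1 - q (i - 1)) - remaining t * radius t"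
      by (simp add: algebra_simps)
    also have "\<dots> \<le> (remaining t - 1) * (1 - q (i - 1)) + 1 - remaining t * radius t"
      using q_01[of "i - 1"] i by auto
    also have "\<dots> < real (count_above (q (i - 1)) t \<omega>)"
    proof -
      have "\<bar>real (count_above (q (i - 1)) t \<omega>) - (remaining t - 1) * (1 - q (i - 1))\<bar>
          < remaining t * radius t - 1" using conc k unfolding concentrated_def by blast
      thus ?thesis by linarith
    qed
    finally show ?thesis using count by simp
  qed
qed

text \<open>
  The mirror image: an accepted candidate of type \<open>i\<close> has \<open>q i\<close> above the threshold, and the later
  candidates above \<open>q i\<close>, the strictly better ones, are too few to use up the budget. Nobody is
  better than the highest type.
\<close>

lemma acceptance_without_loss:
  assumes t: "t \<in> {1..T}" and sep: "1 < m \<Longrightarrow> 2 * radius t \<le> \<epsilon>"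
    and reg: "regular \<omega>" and conc: "concentrated t \<omega>"
    and accept: "p_CwG m p T sel t b \<le> aux \<omega> t" and b: "1 \<le> b"
  shows "card {s\<in>{t+1..T}. ability \<omega> t < ability \<omega> s} < b"
proof -
  obtain i where i: "i \<in> {1..m}" "ability \<omega> t = \<theta> i" "q (i - 1) < aux \<omega> t" "aux \<omega> t < q i"
    using reg t by (rule regular_cases)
  have count: "card {s\<in>{t+1..T}. ability \<omega> t < ability \<omega> s} = count_above (q i) t \<omega>"
    unfolding count_above_def using regular_greater_iff[OF reg _ i(1)] i t
    by (intro arg_cong[where f = card]) auto
  have above: "i = m \<or> p_CE T t b + radius t \<le> q i"
    using above_threshold[OF t sep i(1), of b] i accept by auto
  have n: "remaining t \<ge> 1" using t by (auto simp: remaining_def)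
  show ?thesis
  proof (cases "i = m")
    case True
    have "aux \<omega> s < 1" if s: "s \<in> {t+1..T}" for s
    proof -
      obtain j where j: "j \<in> {1..m}" "aux \<omega> s < q j" 
        using reg s t by (auto elim!: regular_cases[of \<omega> s])
      thus ?thesis using q_01[of j] by auto
    qed
    hence "{s \<in> {t+1..T}. q i \<le> aux \<omega> s} = {}" using True by force
    hence "count_above (q i) t \<omega> = 0" by (simp only: count_above_def card.empty)
    thus ?thesis unfolding count using b by simp
  next
    case False
    hence k: "i \<in> {1..m-1}" using i by auto
    have "real (count_above (q i) t \<omega>) < (remaining t - 1) * (1 - q i) + remaining t * radius t - 1"
    proof -
      have "\<bar>real (count_above (q i) t \<omega>) - (remaining t - 1) * (1 - q i)\<bar>
          < remaining t * radius t - 1" using conc k unfolding concentrated_def by blast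
      thus ?thesis by linarith
    qed
    also have "\<dots> \<le> (remaining t - 1) * (1 - q i) + (1 - q i) + remaining t * radius t"
      using q_01[of i] i by auto
    also have "\<dots> = remaining t * (1 - (q i - radius t))"
      by (simp add: algebra_simps)
    also have "\<dots> \<le> real b"
      using above False n unfolding remaining_mult_p_CE[OF t, of b]
      by (intro mult_left_mono) auto
    finally show ?thesis using count by simp
  qed
qed

lemma phase1_step:
  assumes t: "t \<in> {1..T}" "t \<le> L" and sep: "1 < m \<Longrightarrow> 2 * radius t \<le> \<epsilon>"
    and reg: "regular \<omega>"
  shows "best {t..T} (budget \<omega> t) (ability \<omega>)
    \<le> ability \<omega> t * real (action \<omega> t) + of_bool (\<not> concentrated t \<omega>)
      + best {t+1..T} (budget \<omega> (t + 1)) (ability \<omega>)"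
proof -
  define b where "b = budget \<omega> t"
  let ?\<tau> = "p_CwG m p T sel t b"
  have \<tau>: "cwg_threshold m p T B sel \<omega> t = ?\<tau>"
    using t by (subst cwg_threshold.simps) (simp add: b_def)
  have next_b: "budget \<omega> (t + 1) = b - action \<omega> t"
    using t by (simp add: cwg_budget_Suc b_def)
  have ins: "{t..T} = insert t {t+1..T}" using t by auto
  have v01: "ability \<omega> s \<in> {0..1}" if "s \<in> insert t {t+1..T}" for s
    using that t by (intro regular_01[OF reg]) auto
  show ?thesis
  proof (cases "?\<tau> \<le> aux \<omega> t \<and> 0 < b")
    case True
    hence a: "action \<omega> t = 1" by (simp add: cwg_def \<tau> b_def)
    have "of_bool (b \<le> card {s\<in>{t+1..T}. ability \<omega> t < ability \<omega> s})
        \<le> (of_bool (\<not> concentrated t \<omega>) :: real)"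
      using acceptance_without_loss[OF t(1) sep reg, of b] True by (auto simp: not_le)
    moreover have "best (insert t {t+1..T}) b (ability \<omega>)
        \<le> ability \<omega> t + best {t+1..T} (b - 1) (ability \<omega>)
          + of_bool (b \<le> card {s\<in>{t+1..T}. ability \<omega> t < ability \<omega> s})"
      using True v01 by (intro best_accept) auto
    ultimately show ?thesis
      unfolding next_b a b_def[symmetric] ins by (cases "concentrated t \<omega>") (auto simp: of_bool_def)
  next
    case False
    hence a: "action \<omega> t = 0" by (simp add: cwg_def \<tau> b_def)
    have "of_bool (card {s\<in>{t+1..T}. ability \<omega> t \<le> ability \<omega> s} < b)
        \<le> (of_bool (\<not> concentrated t \<omega>) :: real)"
      using rejection_without_loss[OF t(1) sep reg, of b] False by (auto simp: not_le)
    moreover have "best (insert t {t+1..T}) b (ability \<omega>) \<le> best {t+1..T} b (ability \<omega>)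
          + of_bool (card {s\<in>{t+1..T}. ability \<omega> t \<le> ability \<omega> s} < b)"
      using v01[of t] by (intro best_reject) auto
    ultimately show ?thesis
      unfolding next_b a b_def[symmetric] ins by (cases "concentrated t \<omega>") (auto simp: of_bool_def)
  qed
qed

lemma \<epsilon>_le_1: "\<epsilon> \<le> 1"
proof -
  have "q 0 + \<epsilon> \<le> q m" using m_ge_1 by (intro q_gap) auto
  thus ?thesis by simp
qed

lemma L_le_T: "L \<le> T"
proof -
  have "0 \<le> 64 * ln (1 / \<epsilon>) / \<epsilon>\<^sup>2" using \<epsilon>_pos \<epsilon>_le_1 by simp
  hence "0 \<le> \<lfloor>64 * ln (1 / \<epsilon>) / \<epsilon>\<^sup>2\<rfloor>" by simp
  thus ?thesis unfolding phase1_length_def by linarith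
qed

lemma phase1_regret:
  assumes sep: "\<And>t. t \<in> {1..L} \<Longrightarrow> 1 < m \<Longrightarrow> 2 * radius t \<le> \<epsilon>" and reg: "regular \<omega>"
  shows "best {1..T} B (ability \<omega>)
    \<le> (\<Sum>t=1..L. ability \<omega> t * real (action \<omega> t)) + (\<Sum>t=1..L. of_bool (\<not> concentrated t \<omega>))
      + best {L+1..T} (budget \<omega> (L + 1)) (ability \<omega>)"
proof -
  have "k \<le> L \<Longrightarrow> best {1..T} B (ability \<omega>)
    \<le> (\<Sum>t=1..k. ability \<omega> t * real (action \<omega> t)) + (\<Sum>t=1..k. of_bool (\<not> concentrated t \<omega>))
      + best {k+1..T} (budget \<omega> (k + 1)) (ability \<omega>)" for k
  proof (induction k)
    case 0
    show ?case by (simp add: cwg_budget_1)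
  next
    case (Suc k)
    thus ?case
      using phase1_step[of "Suc k" \<omega>] sep[of "Suc k"] L_le_T reg by simp
  qed
  thus ?thesis by blast
qed

text \<open>
  The candidates above the fixed threshold are the most valuable ones. If they outnumber the budget \<open>b\<close>,
  the policy misses at most the surplus; if there are fewer than the budget or the periods permit, the
  hindsight solution gains at most the shortfall.
\<close>

lemma phase2_regret:
  assumes reg: "regular \<omega>"
  shows "best {L+1..T} (budget \<omega> (L + 1)) (ability \<omega>)
    \<le> (\<Sum>t=L+1..T. ability \<omega> t * real (action \<omega> t))
      + \<bar>real (count_above (p_CE T (L + 1) (budget \<omega> (L + 1))) L \<omega>)
         - real (min (budget \<omega> (L + 1)) (T - L))\<bar>"
proof -
  define b where "b = budget \<omega> (L + 1)"
  define U where "U = {t \<in> {L+1..T}. cwg_threshold m p T B sel \<omega> t \<le> aux \<omega> t}"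
  have thr: "cwg_threshold m p T B sel \<omega> t = p_CE T (L + 1) b" if "t \<in> {L+1..T}" for t
    using that by (subst cwg_threshold.simps) (simp add: b_def)
  have U: "U \<subseteq> {L+1..T}" "finite U" by (auto simp: U_def)
  have cU: "card U = count_above (p_CE T (L + 1) b) L \<omega>"
    unfolding U_def count_above_def using thr by (intro arg_cong[where f = card]) auto
  have v01: "ability \<omega> s \<in> {0..1}" if "s \<in> {L+1..T}" for s
    using that by (intro regular_01[OF reg]) auto
  have "best {L+1..T} b (ability \<omega>)
      \<le> sum (ability \<omega>) U + max 0 (real (min b (card {L+1..T})) - real (card U))"
  proof (rule best_upper_set[OF _ U(1) v01])
    fix s r assume "s \<in> U" "r \<in> {L+1..T} - U"
    thus "ability \<omega> r \<le> ability \<omega> s"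
      using thr[of s] thr[of r] by (intro regular_mono[OF reg]) (auto simp: U_def)
  qed auto
  moreover have "sum (ability \<omega>) U \<le> (\<Sum>t=L+1..T. ability \<omega> t * real (action \<omega> t))
      + real (card {t\<in>U. action \<omega> t = 0})"
  proof -
    have "sum (ability \<omega>) U \<le> (\<Sum>t\<in>U. ability \<omega> t * real (action \<omega> t) + of_bool (action \<omega> t = 0))"
      using v01 U by (intro sum_mono) (auto simp: cwg_def)
    also have "\<dots> = (\<Sum>t\<in>U. ability \<omega> t * real (action \<omega> t)) + real (card {t\<in>U. action \<omega> t = 0})"
      using U(2) by (simp add: sum.distrib of_bool_def sum.If_cases Int_def)
    also have "(\<Sum>t\<in>U. ability \<omega> t * real (action \<omega> t)) \<le> (\<Sum>t=L+1..T. ability \<omega> t * real (action \<omega> t))"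
      using U v01 by (intro sum_mono2) auto
    finally show ?thesis by simp
  qed
  moreover have "real (card {t\<in>U. action \<omega> t = 0}) \<le> max 0 (real (card U) - real b)"
    unfolding U_def b_def by (rule cwg_second_phase_rejections[OF L_le_T])
  moreover have "card U \<le> T - L" using card_mono[OF _ U(1)] by simp
  ultimately show ?thesis unfolding b_def[symmetric] cU[symmetric] by (simp add: min_def split: if_splits)
qed

text \<open>
  Summing the losses of the single periods bounds the regret by the number of first-phase periods
  without concentration and one fluctuation term. The minimum with \<open>T - L\<close> covers a
  budget that exceeds the number of periods left.
\<close>

theorem pathwise_regret:
  assumes sep: "\<And>t. t \<in> {1..L} \<Longrightarrow> 1 < m \<Longrightarrow> 2 * radius t \<le> \<epsilon>" and reg: "regular \<omega>"
  shows "hindsight_optimum B T (ability \<omega>)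
    \<le> (\<Sum>t=1..T. ability \<omega> t * real (action \<omega> t))
      + (\<Sum>t=1..L. of_bool (\<not> concentrated t \<omega>))
      + \<bar>real (count_above (p_CE T (L + 1) (budget \<omega> (L + 1))) L \<omega>)
         - real (min (budget \<omega> (L + 1)) (T - L))\<bar>"
proof -
  have "(\<Sum>t=1..T. ability \<omega> t * real (action \<omega> t))
      = (\<Sum>t=1..L. ability \<omega> t * real (action \<omega> t)) + (\<Sum>t=L+1..T. ability \<omega> t * real (action \<omega> t))"
    using sum.ub_add_nat[of 1 L "\<lambda>t. ability \<omega> t * real (action \<omega> t)" "T - L"] L_le_T by simp
  thus ?thesis
    using hindsight_optimum_le_best[of B T "ability \<omega>"] phase1_regret[OF sep reg] phase2_regret[OF reg] by simp
qed

end

section \<open>Independence, measurability and concentration\<close>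

lemma pred_le_real:
  fixes f g :: "'a \<Rightarrow> real"
  shows "f \<in> borel_measurable N \<Longrightarrow> g \<in> borel_measurable N \<Longrightarrow> Measurable.pred N (\<lambda>x. f x \<le> g x)"
  unfolding pred_def by (rule borel_measurable_le)

context discrete_abilities
begin

lemma prob_space_candidates: "prob_space (candidates F T)"
  unfolding candidates_def by (intro prob_space_PiM prob_space_candidate)

lemma measurable_component [measurable]:
  "t \<in> {1..T} \<Longrightarrow> (\<lambda>\<omega>. \<omega> t) \<in> candidates F T \<rightarrow>\<^sub>M borel"
  using measurable_component_singleton[of t "{1..T}" "\<lambda>_. candidate F"]
  unfolding candidates_def by (simp cong: measurable_cong_sets)

lemma measurable_aux: "t \<in> {1..T} \<Longrightarrow> (\<lambda>\<omega>. aux \<omega> t) \<in> borel_measurable (candidates F T)"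
  by (rule measurable_compose[OF measurable_component measurable_fst_snd_borel(2)])

lemma measurable_ability: "t \<in> {1..T} \<Longrightarrow> (\<lambda>\<omega>. ability \<omega> t) \<in> borel_measurable (candidates F T)"
  by (rule measurable_compose[OF measurable_component measurable_fst_snd_borel(1)])

lemma distr_component:
  assumes "t \<in> {1..T}"
  shows "distr (candidates F T) borel (\<lambda>\<omega>. \<omega> t) = candidate F"
proof -
  have "distr (candidates F T) borel (\<lambda>\<omega>. \<omega> t) = distr (candidates F T) (candidate F) (\<lambda>\<omega>. \<omega> t)"
    by (intro distr_cong) auto
  also have "\<dots> = candidate F"
    unfolding candidates_def using distr_PiM_component[of "{1..T}" "\<lambda>_. candidate F" t] assms
    by (simp add: prob_space_candidate)
  finally show ?thesis .
qed

lemma integral_component: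
  assumes "t \<in> {1..T}" and f: "f \<in> borel_measurable borel"
  shows "(\<integral>\<omega>. f (\<omega> t) \<partial>candidates F T) = (\<integral>y. (f y :: real) \<partial>candidate F)"
  using integral_distr[OF measurable_component[OF assms(1)] f] distr_component[OF assms(1)] by simp

lemma measurable_aux_ge [measurable]:
  "(\<lambda>y. of_bool (c \<le> snd y) :: real) \<in> borel_measurable (borel :: (real \<times> real) measure)"
  unfolding of_bool_def by measurable

lemma integral_aux_ge:
  assumes "c \<in> {0..1}"
  shows "(\<integral>y. of_bool (c \<le> snd y) \<partial>candidate F) = 1 - c"
proof -
  have "(\<integral>y. of_bool (c \<le> snd y) \<partial>candidate F) = (\<integral>y. indicator {y. c \<le> snd y} y \<partial>candidate F)"
    by (intro Bochner_Integration.integral_cong) (auto simp: indicator_def)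
  also have "\<dots> = measure (candidate F) {y. c \<le> snd y}" by simp
  finally show ?thesis using prob_aux_ge[OF assms] by simp
qed

lemma indep_components:
  assumes "1 \<le> T"
  shows "prob_space.indep_vars (candidates F T) (\<lambda>_. borel) (\<lambda>t \<omega>. \<omega> t) {1..T}"
proof -
  interpret P: prob_space "candidates F T" by (rule prob_space_candidates)
  show ?thesis
  proof (subst P.indep_vars_iff_distr_eq_PiM')
    have *: "sets (\<Pi>\<^sub>M t\<in>{1..T}. borel) = sets (candidates F T)"
      unfolding candidates_def by (intro sets_PiM_cong) auto
    have "distr (candidates F T) (\<Pi>\<^sub>M t\<in>{1..T}. borel) (\<lambda>x. \<lambda>t\<in>{1..T}. x t)
        = distr (candidates F T) (candidates F T) (\<lambda>x. x)"
      using * by (intro distr_cong) (auto simp: candidates_def space_PiM PiE_iff fun_eq_iff extensional_def)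
    also have "\<dots> = candidates F T" by simp
    also have "\<dots> = (\<Pi>\<^sub>M t\<in>{1..T}. distr (candidates F T) borel (\<lambda>\<omega>. \<omega> t))"
      unfolding candidates_def
      by (intro PiM_cong refl) (use distr_component[of _ T] in \<open>simp add: candidates_def\<close>)
    finally show "distr (candidates F T) (\<Pi>\<^sub>M t\<in>{1..T}. borel) (\<lambda>x. \<lambda>t\<in>{1..T}. x t)
        = (\<Pi>\<^sub>M t\<in>{1..T}. distr (candidates F T) borel (\<lambda>\<omega>. \<omega> t))" .
  qed (use assms measurable_component in auto)
qed

text \<open>
  By Fubini's theorem a variable integrates to zero if it does so in one coordinate
  for all values of the others. This serves
  as conditioning on all the other periods.
\<close>

lemma integral_eq_0_coordinate:
  fixes f :: "(nat \<Rightarrow> real \<times> real) \<Rightarrow> real"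
  assumes r: "r \<in> {1..T}" and f: "integrable (candidates F T) f"
    and 0: "\<And>\<omega>. (\<integral>y. f (fun_upd \<omega> r y) \<partial>candidate F) = 0"
  shows "(\<integral>\<omega>. f \<omega> \<partial>candidates F T) = 0"
proof -
  interpret C: prob_space "candidate F" by (rule prob_space_candidate)
  interpret product_sigma_finite "\<lambda>_::nat. candidate F" by standard
  have ins: "{1..T} = insert r ({1..T} - {r})" using r by auto
  have "(\<integral>\<omega>. f \<omega> \<partial>candidates F T) = (\<integral>\<omega>. (\<integral>y. f (fun_upd \<omega> r y) \<partial>candidate F)
      \<partial>(\<Pi>\<^sub>M t\<in>{1..T} - {r}. candidate F))"
    unfolding candidates_def using f unfolding candidates_def
    by (subst ins, intro product_integral_insert) (use ins in auto)
  thus ?thesis by (simp add: 0)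
qed

lemma measurable_hindsight_optimum [measurable]:
  "(\<lambda>\<omega>. hindsight_optimum B T (ability \<omega>)) \<in> borel_measurable (candidates F T)"
  unfolding hindsight_optimum_eq_Max using measurable_ability
  by (intro borel_measurable_Max borel_measurable_sum borel_measurable_times finite_feasible_actions) auto

end

context cwg_policy
begin

abbreviation M :: "(nat \<Rightarrow> real \<times> real) measure" where "M \<equiv> candidates F T"

sublocale P: prob_space M by (rule prob_space_candidates)

lemma AE_regular: "AE \<omega> in M. regular \<omega>"
proof -
  have "AE \<omega> in M. \<exists>i\<in>{1..m}. ability \<omega> t = \<theta> i \<and> q (i - 1) < aux \<omega> t \<and> aux \<omega> t < q i"
    if "t \<in> {1..T}" for t
    unfolding candidates_def
    by (rule AE_PiM_component[where M = "\<lambda>_. candidate F", OF prob_space_candidate that AE_candidate])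
  thus ?thesis unfolding regular_def by (intro AE_finite_allI) auto
qed

lemma measurable_budget_threshold:
  "t \<le> T + 1 \<Longrightarrow> (\<lambda>\<omega>. budget \<omega> t) \<in> M \<rightarrow>\<^sub>M count_space UNIV
     \<and> (\<lambda>\<omega>. cwg_threshold m p T B sel \<omega> t) \<in> borel_measurable M"
proof (induction t rule: less_induct)
  case (less t)
  have IH: "(\<lambda>\<omega>. budget \<omega> s) \<in> M \<rightarrow>\<^sub>M count_space UNIV"
     "(\<lambda>\<omega>. cwg_threshold m p T B sel \<omega> s) \<in> borel_measurable M" if "s < t" for s
    using less that by auto
  have b: "(\<lambda>\<omega>. budget \<omega> t) \<in> M \<rightarrow>\<^sub>M count_space UNIV"
  proof (cases "t \<le> 1")
    case True
    thus ?thesis by (simp add: cwg_budget.simps)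
  next
    case False
    hence [measurable]: "(\<lambda>\<omega>. budget \<omega> (t - 1)) \<in> M \<rightarrow>\<^sub>M count_space UNIV"
      and thr: "(\<lambda>\<omega>. cwg_threshold m p T B sel \<omega> (t - 1)) \<in> borel_measurable M"
      and aux: "(\<lambda>\<omega>. aux \<omega> (t - 1)) \<in> borel_measurable M"
      using IH[of "t - 1"] less.prems by (auto intro!: measurable_aux)
    note [measurable] = pred_le_real[OF thr aux]
    have "(\<lambda>\<omega>. budget \<omega> t) = (\<lambda>\<omega>. if cwg_threshold m p T B sel \<omega> (t - 1) \<le> aux \<omega> (t - 1)
        \<and> 0 < budget \<omega> (t - 1) then budget \<omega> (t - 1) - 1 else budget \<omega> (t - 1))"
      using False by (subst cwg_budget.simps) simp
    also have "\<dots> \<in> M \<rightarrow>\<^sub>M count_space UNIV" by measurable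
    finally show ?thesis .
  qed
  have comp: "(\<lambda>\<omega>. h (budget \<omega> s)) \<in> borel_measurable M"
    if "(\<lambda>\<omega>. budget \<omega> s) \<in> M \<rightarrow>\<^sub>M count_space UNIV" for h :: "nat \<Rightarrow> real" and s
    using that by (rule measurable_compose) simp
  have "(\<lambda>\<omega>. cwg_threshold m p T B sel \<omega> t) \<in> borel_measurable M"
  proof (cases "t \<le> L")
    case True
    thus ?thesis using comp[OF b] by (subst cwg_threshold.simps) simp
  next
    case False
    hence "(\<lambda>\<omega>. budget \<omega> (L + 1)) \<in> M \<rightarrow>\<^sub>M count_space UNIV"
      using b IH(1)[of "L + 1"] by (cases "L + 1 = t") auto
    from comp[OF this] show ?thesis using False by (subst cwg_threshold.simps) simp
  qed
  with b show ?case by blast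
qed

lemma measurable_budget: "t \<le> T + 1 \<Longrightarrow> (\<lambda>\<omega>. budget \<omega> t) \<in> M \<rightarrow>\<^sub>M count_space UNIV"
  using measurable_budget_threshold by blast

lemma measurable_action:
  assumes "t \<in> {1..T}"
  shows "(\<lambda>\<omega>. real (action \<omega> t)) \<in> borel_measurable M"
proof -
  have [measurable]: "(\<lambda>\<omega>. budget \<omega> t) \<in> M \<rightarrow>\<^sub>M count_space UNIV"
    and thr: "(\<lambda>\<omega>. cwg_threshold m p T B sel \<omega> t) \<in> borel_measurable M"
    using measurable_budget_threshold[of t] assms by auto
  note [measurable] = pred_le_real[OF thr measurable_aux[OF assms]]
  show ?thesis unfolding cwg_def by measurable
qed

lemma count_above_eq_sum: "real (count_above c t \<omega>) = (\<Sum>s=t+1..T. of_bool (c \<le> aux \<omega> s))"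
  by (simp add: count_above_def of_bool_def sum.If_cases Int_def)

lemma measurable_count_above [measurable]: "(\<lambda>\<omega>. real (count_above c t \<omega>)) \<in> borel_measurable M"
  unfolding count_above_eq_sum
  by (intro borel_measurable_sum measurable_compose[OF measurable_component measurable_aux_ge]) auto

text \<open>
  A sum of \<open>T - t\<close> independent indicators with mean \<open>1 - c\<close>, to which Hoeffding's inequality applies.
\<close>

lemma count_above_tail:
  assumes t: "t < T" and c: "c \<in> {0..1}" and d: "0 \<le> d"
  shows "measure M {\<omega> \<in> space M. d \<le> \<bar>real (count_above c t \<omega>) - real (T - t) * (1 - c)\<bar>}
    \<le> 2 * exp (- 2 * d\<^sup>2 / real (T - t))"
proof -
  let ?X = "\<lambda>s \<omega>. of_bool (c \<le> aux \<omega> s) :: real"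
  have indep: "P.indep_vars (\<lambda>_. borel) ?X {1..T}"
    using indep_components[of T] t by (intro P.indep_vars_compose2[where Y = "\<lambda>_ y. of_bool (c \<le> snd y)"]) auto
  have "P.expectation (?X s) = 1 - c" if "s \<in> {t+1..T}" for s
    using integral_component[of s T "\<lambda>y. of_bool (c \<le> snd y)"] integral_aux_ge[OF c] that by simp
  hence sum: "(\<Sum>s=t+1..T. P.expectation (?X s)) = real (T - t) * (1 - c)"
    using t by simp
  interpret H: Hoeffding_ineq M "{t+1..T}" ?X "\<lambda>_. 0" "\<lambda>_. 1" "\<Sum>s=t+1..T. P.expectation (?X s)"
    by unfold_locales (auto intro: P.indep_vars_subset[OF indep])
  show ?thesis using H.Hoeffding_ineq_abs_ge[OF d] t
    unfolding sum count_above_eq_sum by simp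
qed

end

section \<open>Numerical estimates\<close>

text \<open>
  This is where the length of the second phase comes from. With \<open>x = n e\<^sup>2\<close> and \<open>l = ln (1/e)\<close>, the first claim
  reads \<open>8 (ln x + 2 l) \<le> x\<close>. As \<open>l < x/64\<close>, the term \<open>16 l\<close> costs only a quarter of \<open>x\<close>, and the rest holds
  since \<open>x > 64 ln 2\<close> is large enough to dominate the logarithm.
\<close>

lemma eight_ln_le:
  fixes e n :: real
  assumes e: "0 < e" "e \<le> 1/2" and n: "64 * ln (1 / e) / e\<^sup>2 < n"
  shows "8 * ln n \<le> n * e\<^sup>2" and "64 \<le> n" and "1 / e \<le> n"
proof -
  define l where "l = ln (1 / e)"
  have "ln 2 \<le> l" unfolding l_def using e by (subst ln_le_cancel_iff) (auto simp: field_simps)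
  hence l: "2 / 3 \<le> l" using ln2_ge_two_thirds by simp
  define x where "x = n * e\<^sup>2"
  have x: "64 * l < x" using n e by (simp add: x_def l_def field_simps)
  have x42: "42 < x" using x l by simp
  \<comment> \<open>The tangent of the logarithm at \<open>32\<close>, a power of two close to the smallest possible \<open>x\<close>.\<close>
  have ln_x: "ln x \<le> x / 32 - 1 + 5 * ln 2"
  proof -
    have "ln x = ln (x / 32) + ln 32" using x42 by (subst ln_mult_pos[symmetric]) auto
    also have "ln (32::real) = 5 * ln 2" using ln_realpow[of 2 5] by simp
    also have "ln (x / 32) \<le> x / 32 - 1" using x42 by (intro ln_le_minus_one) auto
    finally show ?thesis by simp
  qed
  have n_eq: "n = x * (1 / e) * (1 / e)" using e by (simp add: x_def power2_eq_square)
  hence "ln n = ln (x * (1 / e) * (1 / e))" by simp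
  also have "\<dots> = ln (x * (1 / e)) + l" unfolding l_def using x42 e by (intro ln_mult_pos) auto
  also have "ln (x * (1 / e)) = ln x + l" unfolding l_def using x42 e by (intro ln_mult_pos) auto
  finally have "ln n = ln x + l + l" .
  with ln_x x x42 show "8 * ln n \<le> n * e\<^sup>2"
    unfolding x_def[symmetric] using ln2_le_25_over_36 by linarith
  have "e * e \<le> 1/2 * (1/2)" using e by (intro mult_mono) auto
  hence e2: "e\<^sup>2 \<le> 1 / 4" by (simp add: power2_eq_square)
  have n0: "0 < n" unfolding n_eq using x42 e by simp
  have "42 < n * (1 / 4)" using x42 mult_left_mono[OF e2, of n] n0 unfolding x_def by linarith
  thus "64 \<le> n" by simp
  have "1 \<le> n * e * e" using x42 by (simp add: x_def power2_eq_square mult.assoc)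
  also have "\<dots> \<le> n * e * 1" using n0 e by (intro mult_left_mono) auto
  finally show "1 / e \<le> n" using e by (simp add: field_simps)
qed

text \<open>
  Without the correction by \<open>1\<close> the exponent would be \<open>-4 ln n\<close>, up to the factor \<open>n / (n - 1)\<close>; since
  \<open>z \<ge> 8\<close>, the correction costs at most a quarter of it. The cube leaves \<open>n\<^sup>-\<^sup>2\<close> after a union bound
  over at most \<open>n\<close> events.
\<close>

lemma exp_tail_le:
  fixes n :: real
  assumes n: "64 \<le> n"
  defines "z \<equiv> sqrt (2 * n * ln n)"
  shows "exp (- 2 * (z - 1)\<^sup>2 / (n - 1)) \<le> 1 / n ^ 3" and "1 \<le> z"
proof -
  have ln: "1 \<le> ln n" using n exp_le by (subst ln_ge_iff) auto
  have z2: "z\<^sup>2 = 2 * n * ln n" unfolding z_def using n ln by (intro real_sqrt_pow2) auto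
  have "8\<^sup>2 \<le> 2 * n * ln n" using mult_mono[of 64 n 1 "ln n"] n ln by simp
  hence z8: "8 \<le> z" unfolding z_def by (rule real_le_rsqrt)
  thus "1 \<le> z" by simp
  have "8 * z \<le> z * z" using z8 by (intro mult_right_mono) auto
  hence "8 * z \<le> z\<^sup>2" by (simp add: power2_eq_square)
  moreover have "(z - 1)\<^sup>2 = z\<^sup>2 - 2 * z + 1" by (simp add: power2_diff)
  ultimately have "3 / 4 * z\<^sup>2 \<le> (z - 1)\<^sup>2" by linarith
  hence "3 * n * ln n \<le> 2 * (z - 1)\<^sup>2" by (simp add: z2)
  moreover have "3 * ln n * (n - 1) \<le> 3 * n * ln n" using ln by (simp add: algebra_simps)
  ultimately have "3 * ln n * (n - 1) \<le> 2 * (z - 1)\<^sup>2" by linarith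
  hence "3 * ln n \<le> 2 * (z - 1)\<^sup>2 / (n - 1)" using n by (subst pos_le_divide_eq) auto
  hence "exp (- 2 * (z - 1)\<^sup>2 / (n - 1)) \<le> exp (- (3 * ln n))" by simp
  also have "\<dots> = 1 / exp (ln n * 3)" by (simp add: exp_minus inverse_eq_divide mult.commute)
  also have "exp (ln n * 3) = n ^ 3" using n exp_of_nat_mult[of 3 "ln n"] by (simp add: mult.commute)
  finally show "exp (- 2 * (z - 1)\<^sup>2 / (n - 1)) \<le> 1 / n ^ 3" .
qed

lemma sum_inverse_squares_le:
  "k < T \<Longrightarrow> (\<Sum>t=1..k. 1 / (real T - real t + 1)\<^sup>2) \<le> 1 / (real T - real k)"
proof (induction k)
  case (Suc k)
  define n where "n = real T - real k"
  have n: "1 < n" using Suc.prems by (simp add: n_def)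
  have "(\<Sum>t=1..Suc k. 1 / (real T - real t + 1)\<^sup>2) \<le> 1 / n + 1 / n\<^sup>2"
    using Suc by (simp add: n_def)
  also have "\<dots> \<le> 1 / (n - 1)" using n by (simp add: field_simps power2_eq_square)
  finally show ?case by (simp add: n_def algebra_simps)
qed simp

section \<open>Expected regret of the two phases\<close>

context cwg_policy
begin

lemma \<epsilon>_le_half: "1 < m \<Longrightarrow> \<epsilon> \<le> 1 / 2"
  using m_mult_\<epsilon>_le_1 \<epsilon>_pos mult_right_mono[of 2 "real m" \<epsilon>] by linarith

lemma remaining_phase1:
  assumes "t \<in> {1..L}"
  shows "64 * ln (1 / \<epsilon>) / \<epsilon>\<^sup>2 < remaining t"
proof -
  have "int t \<le> int T - \<lfloor>64 * ln (1 / \<epsilon>) / \<epsilon>\<^sup>2\<rfloor>"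
    using assms unfolding phase1_length_def atLeastAtMost_iff by linarith
  hence "real_of_int (\<lfloor>64 * ln (1 / \<epsilon>) / \<epsilon>\<^sup>2\<rfloor>) \<le> real_of_int (int T - int t)" by linarith
  thus ?thesis unfolding remaining_def by simp linarith
qed

lemma remaining_mult_radius:
  assumes "64 \<le> remaining t"
  shows "remaining t * radius t = sqrt (2 * remaining t * ln (remaining t))"
proof -
  have "remaining t * radius t = sqrt ((remaining t)\<^sup>2 * (2 * ln (remaining t) / remaining t))"
    unfolding radius_def real_sqrt_mult using assms by simp
  thus ?thesis using assms by (simp add: power2_eq_square)
qed

text \<open>
  Throughout the first phase the intervals of near levels around different gap quantiles overlap at most
  in their end points.
\<close>

lemma radius_le:
  assumes "t \<in> {1..L}" "1 < m"
  shows "2 * radius t \<le> \<epsilon>"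
proof -
  note n = eight_ln_le[OF \<epsilon>_pos \<epsilon>_le_half[OF assms(2)] remaining_phase1[OF assms(1)]]
  have "2 * ln (remaining t) / remaining t \<le> (\<epsilon> / 2)\<^sup>2"
    using n by (simp add: field_simps)
  hence "radius t \<le> \<epsilon> / 2" unfolding radius_def using \<epsilon>_pos by (intro real_le_lsqrt) auto
  thus ?thesis by simp
qed

lemma measurable_concentrated [measurable]: "Measurable.pred M (concentrated t)"
  unfolding concentrated_def by measurable

lemma prob_not_concentrated:
  assumes t: "t \<in> {1..L}"
  shows "P.expectation (\<lambda>\<omega>. of_bool (\<not> concentrated t \<omega>)) \<le> 2 / (remaining t)\<^sup>2"
proof (cases "1 < m")
  case False
  hence "m - 1 = 0" by simp
  thus ?thesis by (simp add: concentrated_def)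
next
  case True
  let ?n = "remaining t"
  let ?d = "?n * radius t - 1"
  let ?E = "\<lambda>k. {\<omega> \<in> space M. ?d \<le> \<bar>real (count_above (q k) t \<omega>) - real (T - t) * (1 - q k)\<bar>}"
  note n = eight_ln_le[OF \<epsilon>_pos \<epsilon>_le_half[OF True] remaining_phase1[OF t]]
  have tT: "t < T" "real (T - t) = ?n - 1" using n(2) by (auto simp: remaining_def)
  note tail = exp_tail_le[OF n(2), folded remaining_mult_radius[OF n(2)]]
  have "P.expectation (\<lambda>\<omega>. of_bool (\<not> concentrated t \<omega>))
      = P.expectation (indicator {\<omega> \<in> space M. \<not> concentrated t \<omega>})"
    by (intro Bochner_Integration.integral_cong) (auto simp: indicator_def)
  also have "\<dots> = measure M {\<omega> \<in> space M. \<not> concentrated t \<omega>}" by (simp add: Int_absorb1 subsetI)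
  also have "{\<omega> \<in> space M. \<not> concentrated t \<omega>} = (\<Union>k\<in>{1..m-1}. ?E k)"
    unfolding tT concentrated_def by (auto simp: not_less)
  also have "measure M \<dots> \<le> (\<Sum>k\<in>{1..m-1}. measure M (?E k))"
    by (intro P.finite_measure_subadditive_finite) auto
  also have "\<dots> \<le> (\<Sum>k\<in>{1..m-1}. 2 * (1 / ?n ^ 3))"
  proof (rule sum_mono)
    fix k assume k: "k \<in> {1..m-1}"
    have "measure M (?E k) \<le> 2 * exp (- 2 * ?d\<^sup>2 / real (T - t))"
      using k tail(2) by (intro count_above_tail tT q_01) auto
    thus "measure M (?E k) \<le> 2 * (1 / ?n ^ 3)" using tail(1) unfolding tT by linarith
  qed
  also have "\<dots> = real (m - 1) * (2 / ?n ^ 3)" by simp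
  also have "\<dots> \<le> ?n * (2 / ?n ^ 3)"
  proof (rule mult_right_mono)
    have "real m \<le> 1 / \<epsilon>" using m_mult_\<epsilon>_le_1 \<epsilon>_pos by (simp add: field_simps)
    thus "real (m - 1) \<le> ?n" using n(3) by linarith
  qed (use n in auto)
  also have "\<dots> = 2 / ?n\<^sup>2" using n(2) by (simp add: power2_eq_square power3_eq_cube)
  finally show ?thesis .
qed

text \<open>
  The threshold of the second phase, cut off at \<open>0\<close> when the budget exceeds the number of periods left.
  This makes \<open>min b (T - L)\<close> the mean number of candidates above it, and \<open>excess\<close> is the centered
  indicator of one such candidate.
\<close>

definition level :: "nat \<Rightarrow> real" where
  "level b = 1 - real (min b (T - L)) / real (T - L)"

lemma level_01: "level b \<in> {0..1}"
  by (auto simp: level_def divide_le_eq)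

definition excess :: "nat \<Rightarrow> real \<times> real \<Rightarrow> real" where
  "excess b y = of_bool (level b \<le> snd y) - (1 - level b)"

lemma abs_excess_le_1: "\<bar>excess b y\<bar> \<le> 1"
  using level_01[of b] by (auto simp: excess_def)

lemma abs_excess_mult_le_1: "\<bar>excess b x * excess b y\<bar> \<le> 1"
  unfolding abs_mult by (intro mult_le_one abs_excess_le_1) auto

lemma count_minus_budget:
  assumes reg: "regular \<omega>" and L: "L < T"
  shows "real (count_above (p_CE T (L + 1) b) L \<omega>) - real (min b (T - L))
    = (\<Sum>s=L+1..T. excess b (\<omega> s))"
proof -
  have "count_above (p_CE T (L + 1) b) L \<omega> = count_above (level b) L \<omega>"
  proof (cases "b \<le> T - L")
    case True
    hence "p_CE T (L + 1) b = level b" using L by (simp add: p_CE_def level_def of_nat_diff)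
    thus ?thesis by simp
  next
    case False
    hence "p_CE T (L + 1) b \<le> 0" "level b = 0"
      using L by (auto simp: p_CE_def level_def of_nat_diff)
    moreover have "0 < aux \<omega> s" if "s \<in> {L+1..T}" for s
      using regular_aux_pos[OF reg, of s] that by simp
    ultimately have "p_CE T (L + 1) b \<le> aux \<omega> s \<and> level b \<le> aux \<omega> s" if "s \<in> {L+1..T}" for s
      using that by fastforce
    thus ?thesis unfolding count_above_def by (intro arg_cong[where f = card]) auto
  qed
  moreover have "real (min b (T - L)) = (\<Sum>s=L+1..T. 1 - level b)"
    using L by (simp add: level_def)
  ultimately show ?thesis
    by (simp add: count_above_eq_sum excess_def sum_subtractf)
qed

lemma measurable_excess:
  assumes "s \<in> {1..T}"
  shows "(\<lambda>\<omega>. excess (budget \<omega> (L + 1)) (\<omega> s)) \<in> borel_measurable M"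
proof (rule measurable_compose_countable[where g = "\<lambda>\<omega>. budget \<omega> (L + 1)"])
  show "(\<lambda>\<omega>. excess b (\<omega> s)) \<in> borel_measurable M" for b
    unfolding excess_def
    using measurable_compose[OF measurable_component[OF assms] measurable_aux_ge[of "level b"]]
    by simp
  show "(\<lambda>\<omega>. budget \<omega> (L + 1)) \<in> M \<rightarrow>\<^sub>M count_space UNIV"
    using L_le_T by (intro measurable_budget) auto
qed

lemma integral_excess: "(\<integral>y. excess b y \<partial>candidate F) = 0"
proof -
  interpret C: prob_space "candidate F" by (rule prob_space_candidate)
  have "integrable (candidate F) (\<lambda>y. of_bool (level b \<le> snd y) :: real)"
    by (intro C.integrable_const_bound[of _ 1]) (auto simp: measurable_aux_ge cong: measurable_cong_sets)
  thus ?thesis using integral_aux_ge[OF level_01[of b]]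
    using C.prob_space by (simp add: excess_def)
qed

text \<open>
  Although both factors share the random threshold, they are uncorrelated: the budget at the beginning
  of the phase and the other factor do not change with the candidate of period \<open>r\<close>, whose
  centered indicator has mean zero for every fixed threshold.
\<close>

lemma excess_uncorrelated:
  assumes "r \<in> {L+1..T}" "s \<in> {L+1..T}" "r \<noteq> s"
  shows "P.expectation (\<lambda>\<omega>. excess (budget \<omega> (L + 1)) (\<omega> s) * excess (budget \<omega> (L + 1)) (\<omega> r)) = 0"
proof (rule integral_eq_0_coordinate)
  let ?f = "\<lambda>\<omega>. excess (budget \<omega> (L + 1)) (\<omega> s) * excess (budget \<omega> (L + 1)) (\<omega> r)"
  show "r \<in> {1..T}" using assms by auto
  show "integrable M ?f"
  proof (rule P.integrable_const_bound[of _ 1])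
    show "AE \<omega> in M. norm (?f \<omega>) \<le> 1" by (simp only: real_norm_def abs_excess_mult_le_1 AE_I2)
    show "?f \<in> borel_measurable M" using assms
      by (intro borel_measurable_times measurable_excess) auto
  qed
  fix \<omega>
  have "budget (fun_upd \<omega> r y) (L + 1) = budget \<omega> (L + 1)" for y
    using assms cwg_depends_on_past[of "L + 1" "fun_upd \<omega> r y" \<omega>] by auto
  thus "(\<integral>y. ?f (fun_upd \<omega> r y) \<partial>candidate F) = 0"
    using assms by (simp add: integral_excess)
qed

text \<open>
  The variance of the sum is at most the number of summands. The first absolute moment follows from
  \<open>\<bar>D\<bar> \<le> D\<^sup>2 / (2 sqrt n) + sqrt n / 2\<close>.
\<close>

lemma expectation_abs_excess_sum:
  assumes L: "L < T"
  shows "P.expectation (\<lambda>\<omega>. \<bar>\<Sum>s=L+1..T. excess (budget \<omega> (L + 1)) (\<omega> s)\<bar>) \<le> sqrt (real (T - L))"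
proof -
  define n where "n = real (T - L)"
  have n: "1 \<le> n" using L by (simp add: n_def)
  let ?g = "\<lambda>s \<omega>. excess (budget \<omega> (L + 1)) (\<omega> s)"
  have int: "integrable M (\<lambda>\<omega>. ?g r \<omega> * ?g s \<omega>)" if "r \<in> {L+1..T}" "s \<in> {L+1..T}" for r s
  proof (rule P.integrable_const_bound[of _ 1])
    show "AE \<omega> in M. norm (?g r \<omega> * ?g s \<omega>) \<le> 1"
      by (simp only: real_norm_def abs_excess_mult_le_1 AE_I2)
    show "(\<lambda>\<omega>. ?g r \<omega> * ?g s \<omega>) \<in> borel_measurable M" using that
      by (intro borel_measurable_times measurable_excess) auto
  qed
  have int_g: "integrable M (?g s)" if "s \<in> {L+1..T}" for s
    using that by (intro P.integrable_const_bound[of _ 1] measurable_excess) (auto simp: abs_excess_le_1)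
  let ?D = "\<lambda>\<omega>. \<Sum>s=L+1..T. ?g s \<omega>"
  have square: "(?D \<omega>)\<^sup>2 = (\<Sum>r=L+1..T. \<Sum>s=L+1..T. ?g r \<omega> * ?g s \<omega>)" for \<omega>
    unfolding power2_eq_square sum_product ..
  have "P.expectation (\<lambda>\<omega>. (?D \<omega>)\<^sup>2)
      = (\<Sum>r=L+1..T. P.expectation (\<lambda>\<omega>. \<Sum>s=L+1..T. ?g r \<omega> * ?g s \<omega>))"
    unfolding square by (intro Bochner_Integration.integral_sum Bochner_Integration.integrable_sum int)
  also have "\<dots> = (\<Sum>r=L+1..T. \<Sum>s=L+1..T. P.expectation (\<lambda>\<omega>. ?g r \<omega> * ?g s \<omega>))"
    by (intro sum.cong refl Bochner_Integration.integral_sum int)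
  also have "\<dots> \<le> (\<Sum>r=L+1..T. \<Sum>s=L+1..T. of_bool (r = s))"
  proof (intro sum_mono)
    fix r s assume rs: "r \<in> {L+1..T}" "s \<in> {L+1..T}"
    show "P.expectation (\<lambda>\<omega>. ?g r \<omega> * ?g s \<omega>) \<le> of_bool (r = s)"
    proof (cases "r = s")
      case True
      have "P.expectation (\<lambda>\<omega>. ?g r \<omega> * ?g s \<omega>) \<le> 1"
      proof (rule P.integral_le_const[OF int[OF rs]])
        show "AE \<omega> in M. ?g r \<omega> * ?g s \<omega> \<le> 1"
          by (rule AE_I2) (rule abs_le_D1[OF abs_excess_mult_le_1])
      qed
      thus ?thesis using True by simp
    next
      case False
      thus ?thesis using excess_uncorrelated[of s r] rs by simp
    qed
  qed
  also have "\<dots> = n" by (simp add: n_def of_bool_def)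
  finally have second_moment: "P.expectation (\<lambda>\<omega>. (?D \<omega>)\<^sup>2) \<le> n" .
  have int_D2: "integrable M (\<lambda>\<omega>. (?D \<omega>)\<^sup>2)"
    unfolding square using int by (intro Bochner_Integration.integrable_sum) auto
  have "P.expectation (\<lambda>\<omega>. \<bar>?D \<omega>\<bar>) \<le> P.expectation (\<lambda>\<omega>. (?D \<omega>)\<^sup>2 / (2 * sqrt n) + sqrt n / 2)"
  proof (rule integral_mono)
    show "integrable M (\<lambda>\<omega>. \<bar>?D \<omega>\<bar>)" using int_g by (intro integrable_abs Bochner_Integration.integrable_sum)
    show "integrable M (\<lambda>\<omega>. (?D \<omega>)\<^sup>2 / (2 * sqrt n) + sqrt n / 2)" using int_D2 by simp
    fix \<omega>
    have "0 \<le> (\<bar>?D \<omega>\<bar> - sqrt n)\<^sup>2" by simp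
    hence "2 * sqrt n * \<bar>?D \<omega>\<bar> \<le> (?D \<omega>)\<^sup>2 + n" using n by (simp add: power2_diff mult_ac)
    thus "\<bar>?D \<omega>\<bar> \<le> (?D \<omega>)\<^sup>2 / (2 * sqrt n) + sqrt n / 2"
      using n by (simp add: field_simps)
  qed
  also have "\<dots> = P.expectation (\<lambda>\<omega>. (?D \<omega>)\<^sup>2) / (2 * sqrt n) + sqrt n / 2"
    using int_D2 by (simp add: P.prob_space)
  also have "\<dots> \<le> n / (2 * sqrt n) + sqrt n / 2"
    using second_moment n by (intro add_right_mono divide_right_mono) auto
  also have "\<dots> = sqrt n" using n by (simp add: real_div_sqrt field_simps)
  finally show ?thesis by (simp add: n_def)
qed

lemma integrable_hindsight_optimum: "integrable M (\<lambda>\<omega>. hindsight_optimum B T (ability \<omega>))"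
proof (rule P.integrable_const_bound[OF _ measurable_hindsight_optimum])
  have bound: "hindsight_optimum B T (ability \<omega>) \<in> {0..real T}" if reg: "regular \<omega>" for \<omega>
  proof -
    have "hindsight_optimum B T (ability \<omega>)
        \<in> (\<lambda>a. \<Sum>t=1..T. ability \<omega> t * real (a t)) ` feasible_actions B T"
      unfolding hindsight_optimum_eq_Max
      by (intro Max_in finite_imageI finite_feasible_actions) (simp add: feasible_actions_nonempty)
    then obtain a where a: "a \<in> {1..T} \<rightarrow>\<^sub>E {0, 1::nat}"
      "hindsight_optimum B T (ability \<omega>) = (\<Sum>t=1..T. ability \<omega> t * real (a t))"
      unfolding feasible_actions_def by blast
    have term_01: "ability \<omega> t * real (a t) \<in> {0..1}" if "t \<in> {1..T}" for t
      using regular_01[OF reg that] PiE_mem[OF a(1) that] by auto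
    have "0 \<le> (\<Sum>t=1..T. ability \<omega> t * real (a t))"
      using term_01 by (intro sum_nonneg) auto
    moreover have "(\<Sum>t=1..T. ability \<omega> t * real (a t)) \<le> (\<Sum>t=1..T. 1)"
      using term_01 by (intro sum_mono) auto
    ultimately show ?thesis by (simp add: a(2))
  qed
  show "AE \<omega> in M. norm (hindsight_optimum B T (ability \<omega>)) \<le> real T"
    using AE_regular by eventually_elim (use bound in auto)
qed

lemma integrable_reward: "integrable M (\<lambda>\<omega>. \<Sum>t=1..T. ability \<omega> t * real (action \<omega> t))"
proof (rule Bochner_Integration.integrable_sum)
  fix t assume t: "t \<in> {1..T}"
  show "integrable M (\<lambda>\<omega>. ability \<omega> t * real (action \<omega> t))"
  proof (rule P.integrable_const_bound[of _ 1])
    show "AE \<omega> in M. norm (ability \<omega> t * real (action \<omega> t)) \<le> 1"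
      using AE_regular by eventually_elim (use regular_01 t in \<open>auto simp: cwg_def\<close>)
    show "(\<lambda>\<omega>. ability \<omega> t * real (action \<omega> t)) \<in> borel_measurable M"
      using t by (intro borel_measurable_times measurable_ability measurable_action)
  qed
qed

lemma regret_le:
  "regret F B T (cwg m p T B sel)
    \<le> (\<Sum>t=1..L. P.expectation (\<lambda>\<omega>. of_bool (\<not> concentrated t \<omega>))) + sqrt (real (T - L))"
proof -
  let ?H = "\<lambda>\<omega>. hindsight_optimum B T (ability \<omega>)"
  let ?R = "\<lambda>\<omega>. \<Sum>t=1..T. ability \<omega> t * real (action \<omega> t)"
  let ?C = "\<lambda>\<omega>. \<Sum>t=1..L. of_bool (\<not> concentrated t \<omega>) :: real"
  let ?D = "\<lambda>\<omega>. \<bar>\<Sum>s=L+1..T. excess (budget \<omega> (L + 1)) (\<omega> s)\<bar>"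
  have int_C1: "integrable M (\<lambda>\<omega>. of_bool (\<not> concentrated t \<omega>) :: real)" for t
    by (intro P.integrable_const_bound[of _ 1]) (simp_all add: of_bool_def)
  have int_C: "integrable M ?C" by (intro Bochner_Integration.integrable_sum int_C1)
  have int_D: "integrable M ?D"
    by (intro integrable_abs Bochner_Integration.integrable_sum P.integrable_const_bound[of _ 1] measurable_excess)
       (auto simp: abs_excess_le_1)
  have "AE \<omega> in M. ?H \<omega> \<le> ?R \<omega> + ?C \<omega> + ?D \<omega>"
    using AE_regular
  proof eventually_elim
    case (elim \<omega>)
    have "\<bar>real (count_above (p_CE T (L + 1) (budget \<omega> (L + 1))) L \<omega>)
         - real (min (budget \<omega> (L + 1)) (T - L))\<bar> = ?D \<omega>"
    proof (cases "L < T")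
      case True
      show ?thesis unfolding count_minus_budget[OF elim True] ..
    next
      case False
      thus ?thesis by (simp add: count_above_def)
    qed
    thus ?case using pathwise_regret[OF radius_le elim] by simp
  qed
  hence "P.expectation ?H \<le> P.expectation (\<lambda>\<omega>. ?R \<omega> + ?C \<omega> + ?D \<omega>)"
    by (intro integral_mono_AE Bochner_Integration.integrable_add integrable_hindsight_optimum
        integrable_reward int_C int_D)
  also have "\<dots> = P.expectation ?R + P.expectation ?C + P.expectation ?D"
    using integrable_reward int_C int_D by simp
  also have "P.expectation ?C = (\<Sum>t=1..L. P.expectation (\<lambda>\<omega>. of_bool (\<not> concentrated t \<omega>)))"
    by (intro Bochner_Integration.integral_sum int_C1)
  also have "P.expectation ?D \<le> sqrt (real (T - L))"
    using expectation_abs_excess_sum by (cases "L < T") auto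
  finally show ?thesis by (simp add: regret_def)
qed

text \<open>
  The second phase contributes \<open>8\<close> to the constant and the first phase contributes \<open>2\<close>, since
  \<open>1 \<le> sqrt (ln (1/\<epsilon>)) / \<epsilon>\<close> if there are two types or more.
\<close>

theorem regret_bound: "regret F B T (cwg m p T B sel) \<le> 10 * sqrt (ln (1 / \<epsilon>)) / \<epsilon>"
proof (cases "1 < m")
  case False
  hence m1: "m = 1" using m_ge_1 by linarith
  have "\<epsilon> = p 1" by (simp add: min_mass_def m1)
  moreover have "p 1 = q m" by (simp add: gap_quantile_def m1)
  ultimately have "\<epsilon> = 1" by (simp only: q_m)
  moreover from this have "L = T" by (simp add: phase1_length_def)
  moreover have "{1..m-1} = {}" using m1 by simp
  hence "concentrated t \<omega>" for t \<omega> unfolding concentrated_def by blast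
  ultimately show ?thesis using regret_le by simp
next
  case True
  define l where "l = ln (1 / \<epsilon>)"
  have e: "0 < \<epsilon>" "\<epsilon> \<le> 1 / 2" using \<epsilon>_pos \<epsilon>_le_half[OF True] by auto
  have "ln 2 \<le> l" unfolding l_def using e by (subst ln_le_cancel_iff) (auto simp: field_simps)
  hence l: "2 / 3 \<le> l" using ln2_ge_two_thirds by simp
  have "1 / 2 \<le> sqrt l" using l by (intro real_le_rsqrt) (auto simp: power2_eq_square)
  hence "1 / 2 / \<epsilon> \<le> sqrt l / \<epsilon>" using e by (intro divide_right_mono) auto
  moreover have "1 \<le> 1 / 2 / \<epsilon>" using e by (simp add: field_simps)
  ultimately have one: "1 \<le> sqrt l / \<epsilon>" by linarith
  have floor: "T - L \<le> nat \<lfloor>64 * l / \<epsilon>\<^sup>2\<rfloor>"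
    by (simp add: phase1_length_def l_def)
  have l0: "0 \<le> 64 * l / \<epsilon>\<^sup>2" using l by simp
  have "real (T - L) \<le> 64 * l / \<epsilon>\<^sup>2"
    using floor l0 of_nat_floor[of "64 * l / \<epsilon>\<^sup>2"] by linarith
  hence "sqrt (real (T - L)) \<le> sqrt (64 * l / \<epsilon>\<^sup>2)" by simp
  also have "\<dots> = 8 * (sqrt l / \<epsilon>)"
    using e real_sqrt_mult[of 64 l] by (simp add: real_sqrt_divide)
  finally have phase2: "sqrt (real (T - L)) \<le> 8 * (sqrt l / \<epsilon>)" .
  have "(\<Sum>t=1..L. P.expectation (\<lambda>\<omega>. of_bool (\<not> concentrated t \<omega>))) \<le> (2::real)"
  proof (cases "L = 0")
    case False
    have "64 \<le> remaining L"
      using eight_ln_le(2)[OF e remaining_phase1[of L]] False by simp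
    hence LT: "L < T" by (auto simp: remaining_def)
    have "(\<Sum>t=1..L. P.expectation (\<lambda>\<omega>. of_bool (\<not> concentrated t \<omega>)))
        \<le> (\<Sum>t=1..L. 2 * (1 / (real T - real t + 1)\<^sup>2))"
      using prob_not_concentrated by (intro sum_mono) (simp add: remaining_def)
    also have "\<dots> = 2 * (\<Sum>t=1..L. 1 / (real T - real t + 1)\<^sup>2)"
      by (rule sum_distrib_left[symmetric])
    also have "\<dots> \<le> 2 * (1 / (real T - real L))"
      by (intro mult_left_mono sum_inverse_squares_le LT) simp
    also have "\<dots> \<le> 2" using LT by (simp add: field_simps)
    finally show ?thesis .
  qed simp
  with regret_le phase2 one show ?thesis unfolding l_def[symmetric] by simp
qed

end

theorem corollary2:
  "\<exists>C::real. \<forall>(m::nat) (\<theta>::nat \<Rightarrow> real) (p::nat \<Rightarrow> real) (F::real pmf) (T::nat) (B::nat) sel.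
     1 \<le> m \<longrightarrow> strict_mono_on {1..m} \<theta> \<longrightarrow> \<theta> ` {1..m} \<subseteq> {0..1} \<longrightarrow>
     set_pmf F = \<theta> ` {1..m} \<longrightarrow> (\<forall>i\<in>{1..m}. pmf F (\<theta> i) = p i \<and> 0 < p i) \<longrightarrow>
     B \<in> {1..T} \<longrightarrow> nearest_gap_selection m p T sel \<longrightarrow>
     regret F B T (cwg m p T B sel) \<le> C * sqrt (ln (1 / min_mass m p)) / min_mass m p"
proof (intro exI[of _ 10] allI impI)
  fix m :: nat and \<theta> p :: "nat \<Rightarrow> real" and F :: "real pmf" and T B :: nat
    and sel :: "nat \<Rightarrow> nat \<Rightarrow> nat"
  assume "1 \<le> m" "strict_mono_on {1..m} \<theta>" "\<theta> ` {1..m} \<subseteq> {0..1}" "set_pmf F = \<theta> ` {1..m}"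
    "\<forall>i\<in>{1..m}. pmf F (\<theta> i) = p i \<and> 0 < p i" "nearest_gap_selection m p T sel"
  then interpret cwg_policy m \<theta> p F T B sel by unfold_locales auto
  show "regret F B T (cwg m p T B sel) \<le> 10 * sqrt (ln (1 / min_mass m p)) / min_mass m p"
    by (rule regret_bound)
qed

end
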